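(* Let $R$ be a finite reference set in a metric space $(X,d)$, let $q\in X$ be a query point and let $1\le k\le |R|$ be an integer. Let $c(R\cup\{q\})$ be the expansion constant of $R\cup\{q\}$ and $c_m(R)$ the minimized expansion constant of $R$. Given a compressed cover tree $\mathcal T(R)$, the algorithm $\mathrm{kNN}$ (described in the context) finds all $k$-nearest neighbors of $q$ in time $$O\Big(c(R\cup\{q\})^2\cdot\log_2(k)\cdot\big((c_m(R))^{10}\cdot\log_2(|R|)+c(R\cup\{q\})\cdot k\big)\Big),$$ where the constant hidden in $O(\cdot)$ is absolute.
   Context: **Nearest neighbors.** For $q\in X$ let $d_1\le\dots\le d_{|R|}$ be the ordered distances from $q$ to all points of $R$; write $d_k(q,R)=d_k$ and $\mathrm{NN}_k(q;R)=\{u\in R: d(q,u)\le d_k\}$. Finding all $k$-nearest neighbors of $q$ means outputting $k$ distinct points of $\mathrm{NN}_k(q;R)$ at distances $d_1,\dots,d_k$ from $q$ (ties resolved arbitrarily). **Expansion constants.** $\bar B(p,t)$ is the closed ball with center $p$ and radius $t\ge 0$. A set $A\subseteq X$ is locally finite if $\bar B(p,t)\cap A$ is finite for all $p\in X$, $t\ge 0$. For finite $S\subseteq X$, $c(S)$ is the smallest real number $c(S)\ge 2$ such that $|\bar B(p,2t)\cap S|\le c(S)\cdot|\bar B(p,t)\cap S|$ for all $p\in S$, $t\ge 0$, and $$c_m(S)=\lim_{\xi\to 0^+}\ \inf_{S\subseteq A\subseteq X}\ \sup_{p\in A,\,t>\xi}\frac{|\bar B(p,2t)\cap A|}{|\bar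 B(p,t)\cap A|},$$ where $A$ runs over locally finite sets containing $S$. **Compressed cover tree.** For a finite set $R\subseteq X$, a compressed cover tree $\mathcal T(R)$ is a rooted tree with vertex set $R$, a root $r$ and a level function $l:R\to\mathbb Z$ such that: (a) $l(r)\ge 1+\max_{p\in R\setminus\{r\}}l(p)$; (b) every $q\in R\setminus\{r\}$ has a unique parent $p$, and $d(q,p)\le 2^{l(q)+1}$, $l(q)<l(p)$; (c) for each $i\in\mathbb Z$ the cover set $C_i=\{p\in R: l(p)\ge i\}$ satisfies $d(p,q)>2^i$ for all distinct $p,q\in C_i$. Set $l_{\max}=1+\max_{p\in R\setminus\{r\}}l(p)$ and $l_{\min}=\min_{p\in R}l(p)$. $\mathrm{Desc}(p)$ is the set of all descendants of $p$, including $p$. $\mathrm{Next}(a,i)$ is the maximal level $j<i$ such that $a$ has a child (different from $a$) of level $j$; if none exists, $\mathrm{Next}(a,i)=l_{\min}-1$. **Distinctive descendant sets.** For $i\le l(p)$, $\mathcal S_i(p)=\mathrm{Desc}(p)\setminus\bigcup_{u\in V_i(p)}\mathrm{Desc}(u)$, where $V_i(p)=\{u\in\mathrm{Desc}(p): i\le l(u)\le l(p)-1\}$. **$\lambda$-point.** For $C\subseteq C_i$ with $\sum_{p\in C}|\mathcal S_i(p)|\ge k$, $\lambda_k(q,C)$ is a point $\lambda\in C$ minimizing $d(q,\lambda)$ subject to $\sum_{p\in N(q;\lambda)}|\mathcal S_i(p)|\ge k$, where $N(q;\lambda)=\{p\in C: d(q,p)\le d(q,\lambda)\}$. It is computed by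 selecting the $k$ points of $C$ nearest to $q$ (all of $C$ if $|C|<k$) with a binary heap of size at most $k$ and then taking partial sums of the sizes $|\mathcal S_i(p)|$. **Algorithm kNN$(\mathcal T(R),q,k)$.** Set $R_{l_{\max}}=\{r\}$, $i=l_{\max}-1$, $i^+=l_{\max}$ (if $R=\{r\}$, output $r$). While $i\ge l_{\min}$: put $\mathcal C_i=R_{i^+}\cup\{a: a\text{ is a child of some }p\in R_{i^+},\ l(a)=i\}$, $\lambda=\lambda_k(q,\mathcal C_i)$ and $R_i=\{p\in\mathcal C_i: d(q,p)\le d(q,\lambda)+2^{i+2}\}$. If $d(q,\lambda)>2^{i+2}$, collect $S=\bigcup_{p\in R_i}\mathcal S_i(p)$ by traversing the tree, output the $k$ points of $S$ nearest to $q$ and stop. Otherwise let $j=\max_{a\in R_i}\mathrm{Next}(a,i)$, set $j^+=i$ and $i\leftarrow j$. If the loop ends without stopping, output the $k$ points nearest to $q$ in the last computed set $R_i$. Selecting the $k$ nearest points from a set $S$ uses a binary heap of size at most $k$. **Cost conventions.** Distance evaluations and elementary operations have unit cost. Children of each node are stored grouped by level in a linked hash map, so that the group at a given level, the passage from $i$ to $\mathrm{Next}(a,i)$, and the top child level are accessible in $O(1)$ time. The sizes $|\mathcal S_i(p)|$ are assumed precomputed and retrievable in $O(1)$ time. A logarithmic factor inside $O(\cdot)$ is read as $\max\{1,\log_2(\cdot)\}$. *)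

theory Defs
  imports "HOL-Analysis.Analysis" "HOL-Library.Tree" "HOL-Library.Monad_Syntax"
begin

section \<open>Nearest neighbors\<close>

definition sorted_distances :: "('a \<Rightarrow> 'a \<Rightarrow> real) \<Rightarrow> 'a \<Rightarrow> 'a set \<Rightarrow> real list" where
  "sorted_distances d q R = sorted_list_of_multiset (image_mset (d q) (mset_set R))"

text \<open>List positions start at 0, so \<open>d\<^sub>k\<close> is at position \<open>k - 1\<close>.\<close>

definition nn_dist :: "('a \<Rightarrow> 'a \<Rightarrow> real) \<Rightarrow> nat \<Rightarrow> 'a \<Rightarrow> 'a set \<Rightarrow> real" where
  "nn_dist d k q R = sorted_distances d q R ! (k - 1)"

definition NN :: "('a \<Rightarrow> 'a \<Rightarrow> real) \<Rightarrow> nat \<Rightarrow> 'a \<Rightarrow> 'a set \<Rightarrow> 'a set" where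
  "NN d k q R = {u \<in> R. d q u \<le> nn_dist d k q R}"

definition all_k_nearest_neighbors ::
    "('a \<Rightarrow> 'a \<Rightarrow> real) \<Rightarrow> nat \<Rightarrow> 'a \<Rightarrow> 'a set \<Rightarrow> 'a list \<Rightarrow> bool" where
  "all_k_nearest_neighbors d k q R us \<longleftrightarrow>
     length us = k \<and> distinct us \<and> set us \<subseteq> NN d k q R \<and>
     (\<forall>j\<in>{1..k}. d q (us ! (j - 1)) = nn_dist d j q R)"


section \<open>Expansion constants\<close>

context Metric_space
begin

definition locally_finite_set :: "'a set \<Rightarrow> bool" where
  "locally_finite_set A \<longleftrightarrow> (\<forall>p\<in>M. \<forall>t\<ge>0. finite (mcball p t \<inter> A))"

definition expansion_constant :: "'a set \<Rightarrow> real" where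
  "expansion_constant S =
     (LEAST c. c \<ge> 2 \<and>
        (\<forall>p\<in>S. \<forall>t\<ge>0. real (card (mcball p (2 * t) \<inter> S)) \<le> c * real (card (mcball p t \<inter> S))))"

text \<open>The supremum may be infinite for an individual \<open>A\<close>, hence \<^typ>\<open>ereal\<close>. For finite nonempty
  \<open>S\<close> the limit lies between 1 and \<open>card S\<close> (take \<open>A = S\<close> for the upper bound), so
  \<^const>\<open>real_of_ereal\<close> loses nothing.\<close>

definition minimized_expansion_constant :: "'a set \<Rightarrow> real" where
  "minimized_expansion_constant S = real_of_ereal
     (Lim (at_right 0) (\<lambda>\<xi>::real.
        INF A \<in> {A. S \<subseteq> A \<and> A \<subseteq> M \<and> locally_finite_set A}.
          SUP (p, t) \<in> A \<times> {\<xi><..}.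
            ereal (real (card (mcball p (2 * t) \<inter> A)) / real (card (mcball p t \<inter> A)))))"

end


section \<open>Compressed cover trees\<close>

record 'a rooted_tree =
  verts :: "'a set"
  root_of :: 'a
  parent_of :: "'a \<Rightarrow> 'a"  \<comment> \<open>irrelevant at the root and outside \<open>verts\<close>\<close>
  level_of :: "'a \<Rightarrow> int"

definition children :: "'a rooted_tree \<Rightarrow> 'a \<Rightarrow> 'a set" where
  "children T p = {a \<in> verts T - {root_of T}. parent_of T a = p}"

definition l_max :: "'a rooted_tree \<Rightarrow> int" where
  "l_max T = 1 + Max (level_of T ` (verts T - {root_of T}))"

definition l_min :: "'a rooted_tree \<Rightarrow> int" where
  "l_min T = Min (level_of T ` verts T)"

definition cover_set :: "'a rooted_tree \<Rightarrow> int \<Rightarrow> 'a set" where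
  "cover_set T i = {p \<in> verts T. level_of T p \<ge> i}"

text \<open>Levels strictly increase along \<open>parent_of\<close>, so every vertex reaches the root by finitely
  many parent steps; the conditions below thus make \<open>T\<close> a rooted tree without a separate
  connectedness or acyclicity axiom. If \<open>R = {root_of T}\<close>, the maximum in \<open>l_max\<close> ranges over the
  empty set and the root condition is void.\<close>

definition compressed_cover_tree ::
    "('a \<Rightarrow> 'a \<Rightarrow> real) \<Rightarrow> 'a set \<Rightarrow> 'a rooted_tree \<Rightarrow> bool" where
  "compressed_cover_tree d R T \<longleftrightarrow>
     finite R \<and> verts T = R \<and> root_of T \<in> R \<and>
     (R \<noteq> {root_of T} \<longrightarrow> level_of T (root_of T) \<ge> l_max T) \<and>
     (\<forall>q \<in> R - {root_of T}.
        parent_of T q \<in> R \<and>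
        d q (parent_of T q) \<le> 2 powi (level_of T q + 1) \<and>
        level_of T q < level_of T (parent_of T q)) \<and>
     (\<forall>i. \<forall>p \<in> cover_set T i. \<forall>q \<in> cover_set T i. p \<noteq> q \<longrightarrow> d p q > 2 powi i)"

definition Desc :: "'a rooted_tree \<Rightarrow> 'a \<Rightarrow> 'a set" where
  "Desc T p = {u. (p, u) \<in> {(x, a). a \<in> children T x}\<^sup>*}"

definition Next :: "'a rooted_tree \<Rightarrow> 'a \<Rightarrow> int \<Rightarrow> int" where
  "Next T a i =
     (let L = {j \<in> level_of T ` children T a. j < i} in if L = {} then l_min T - 1 else Max L)"

definition V :: "'a rooted_tree \<Rightarrow> int \<Rightarrow> 'a \<Rightarrow> 'a set" where
  "V T i p = {u \<in> Desc T p. i \<le> level_of T u \<and> level_of T u \<le> level_of T p - 1}"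

definition distinctive_descendants :: "'a rooted_tree \<Rightarrow> int \<Rightarrow> 'a \<Rightarrow> 'a set" where
  "distinctive_descendants T i p = Desc T p - (\<Union>u \<in> V T i p. Desc T u)"

text \<open>\<open>grp p i\<close> is the stored group of the children of \<open>p\<close> at level \<open>i\<close>; the order within a group
  is arbitrary.\<close>

definition stores_children :: "'a rooted_tree \<Rightarrow> ('a \<Rightarrow> int \<Rightarrow> 'a list) \<Rightarrow> bool" where
  "stores_children T grp \<longleftrightarrow>
     (\<forall>p \<in> verts T. \<forall>i.
        distinct (grp p i) \<and> set (grp p i) = {a \<in> children T p. level_of T a = i})"


section \<open>Computations with a cost counter\<close>

text \<open>\<open>Some (x, t)\<close> is a computation that terminates with value \<open>x\<close> after \<open>t\<close> time units, and
  \<^const>\<open>None\<close> is one that diverges or fails. A unit stands for a bounded number of elementary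
  operations: evaluating a distance, comparing or adding numbers, allocating or visiting a heap node
  or a list entry, retrieving the size of a distinctive descendant set, or accessing the linked hash
  map of children (the group at a given level, or \<^const>\<open>Next\<close>).\<close>

type_synonym 'b timed = "('b \<times> nat) option"

definition ret :: "'b \<Rightarrow> 'b timed" where
  "ret x = Some (x, 0)"

definition tick :: "nat \<Rightarrow> unit timed" where
  "tick n = Some ((), n)"

definition timed_bind :: "'b timed \<Rightarrow> ('b \<Rightarrow> 'c timed) \<Rightarrow> 'c timed" where
  "timed_bind m f =
     Option.bind m (\<lambda>xs. Option.bind (f (fst xs)) (\<lambda>yt. Some (fst yt, snd xs + snd yt)))"

no_adhoc_overloading Monad_Syntax.bind \<rightleftharpoons> Option.bind
adhoc_overloading Monad_Syntax.bind \<rightleftharpoons> timed_bind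

lemma timed_bind_mono [partial_function_mono]:
  assumes "mono_option m" "\<And>x. mono_option (\<lambda>f. g x f)"
  shows "mono_option (\<lambda>f. timed_bind (m f) (\<lambda>x. g x f))"
  unfolding timed_bind_def by (intro partial_function_mono assms)


section \<open>Selecting the nearest points with a binary heap\<close>

text \<open>Max-heaps of pairs (distance to the query point, point), ordered by the first component. The
  trees are kept balanced in the manner of Braun: a left subtree has the same size as the right one
  or one node more. All costs are proportional to the number of visited nodes, so logarithmic bounds
  are consequences of this shape and are not built in.\<close>

type_synonym 'a heap = "(real \<times> 'a) tree"

fun heap_insert :: "real \<times> 'a \<Rightarrow> 'a heap \<Rightarrow> 'a heap timed" where
  "heap_insert x \<langle>\<rangle> = do { tick 1; ret \<langle>\<langle>\<rangle>, x, \<langle>\<rangle>\<rangle> }"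
| "heap_insert x \<langle>l, y, r\<rangle> = do {
     tick 1;
     if fst y < fst x
     then do { r' \<leftarrow> heap_insert y r; ret \<langle>r', x, l\<rangle> }
     else do { r' \<leftarrow> heap_insert x r; ret \<langle>r', y, l\<rangle> }
   }"

function (sequential) sift_down :: "'a heap \<Rightarrow> real \<times> 'a \<Rightarrow> 'a heap \<Rightarrow> 'a heap timed" where
  "sift_down \<langle>\<rangle> x r = do { tick 1; ret \<langle>\<langle>\<rangle>, x, r\<rangle> }"
| "sift_down \<langle>l1, y, r1\<rangle> x \<langle>\<rangle> = do {
     tick 1;
     if fst x < fst y then ret \<langle>\<langle>l1, x, r1\<rangle>, y, \<langle>\<rangle>\<rangle> else ret \<langle>\<langle>l1, y, r1\<rangle>, x, \<langle>\<rangle>\<rangle>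
   }"
| "sift_down \<langle>l1, y, r1\<rangle> x \<langle>l2, z, r2\<rangle> = do {
     tick 1;
     if fst y \<le> fst x \<and> fst z \<le> fst x then ret \<langle>\<langle>l1, y, r1\<rangle>, x, \<langle>l2, z, r2\<rangle>\<rangle>
     else if fst z \<le> fst y
     then do { l' \<leftarrow> sift_down l1 x r1; ret \<langle>l', y, \<langle>l2, z, r2\<rangle>\<rangle> }
     else do { r' \<leftarrow> sift_down l2 x r2; ret \<langle>\<langle>l1, y, r1\<rangle>, z, r'\<rangle> }
   }"
  by pat_completeness auto
termination
  by (relation "Wellfounded.measure (\<lambda>(l, x, r). size l + size r)") auto

fun remove_leftmost :: "'a heap \<Rightarrow> ((real \<times> 'a) \<times> 'a heap) timed" where
  "remove_leftmost \<langle>\<rangle> = None"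
| "remove_leftmost \<langle>\<langle>\<rangle>, x, r\<rangle> = do { tick 1; ret (x, r) }"
| "remove_leftmost \<langle>\<langle>ll, y, lr\<rangle>, x, r\<rangle> = do {
     tick 1;
     (z, l') \<leftarrow> remove_leftmost \<langle>ll, y, lr\<rangle>;
     ret (z, \<langle>r, x, l'\<rangle>)
   }"

fun extract_max :: "'a heap \<Rightarrow> ((real \<times> 'a) \<times> 'a heap) timed" where
  "extract_max \<langle>\<rangle> = None"
| "extract_max \<langle>\<langle>\<rangle>, x, r\<rangle> = do { tick 1; ret (x, r) }"
| "extract_max \<langle>\<langle>ll, y, lr\<rangle>, x, r\<rangle> = do {
     tick 1;
     (z, l') \<leftarrow> remove_leftmost \<langle>ll, y, lr\<rangle>;
     h \<leftarrow> sift_down r z l';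
     ret (x, h)
   }"

text \<open>The first argument \<open>n\<close> of \<open>fill_heap\<close> and \<open>drain_heap\<close> is the current size of the heap.\<close>

fun fill_heap :: "nat \<Rightarrow> nat \<Rightarrow> (real \<times> 'a) list \<Rightarrow> 'a heap \<Rightarrow> (nat \<times> 'a heap) timed" where
  "fill_heap n k [] h = do { tick 1; ret (n, h) }"
| "fill_heap n k (x # xs) h = do {
     tick 1;
     if n < k then do { h' \<leftarrow> heap_insert x h; fill_heap (Suc n) k xs h' }
     else case h of
       \<langle>\<rangle> \<Rightarrow> fill_heap n k xs h
     | \<langle>l, y, r\<rangle> \<Rightarrow>
         if fst x < fst y then do { h' \<leftarrow> sift_down l x r; fill_heap n k xs h' }
         else fill_heap n k xs h
   }"

fun drain_heap :: "nat \<Rightarrow> 'a heap \<Rightarrow> (real \<times> 'a) list \<Rightarrow> (real \<times> 'a) list timed" where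
  "drain_heap 0 h acc = do { tick 1; ret acc }"
| "drain_heap (Suc n) h acc = do {
     tick 1;
     (x, h') \<leftarrow> extract_max h;
     drain_heap n h' (x # acc)
   }"

definition with_distances ::
    "('a \<Rightarrow> 'a \<Rightarrow> real) \<Rightarrow> 'a \<Rightarrow> 'a list \<Rightarrow> (real \<times> 'a) list timed" where
  "with_distances d q ps = do { tick (length ps); ret (map (\<lambda>p. (d q p, p)) ps) }"

text \<open>The \<open>k\<close> nearest entries (all entries if there are fewer), by increasing distance.\<close>

definition select_nearest :: "nat \<Rightarrow> (real \<times> 'a) list \<Rightarrow> (real \<times> 'a) list timed" where
  "select_nearest k es = do {
     (n, h) \<leftarrow> fill_heap 0 k es \<langle>\<rangle>;
     drain_heap n h []
   }"

definition output_nearest ::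
    "('a \<Rightarrow> 'a \<Rightarrow> real) \<Rightarrow> 'a \<Rightarrow> nat \<Rightarrow> 'a list \<Rightarrow> 'a list timed" where
  "output_nearest d q k ps = do {
     es \<leftarrow> with_distances d q ps;
     sel \<leftarrow> select_nearest k es;
     tick (length sel);
     ret (map snd sel)
   }"


section \<open>The algorithm\<close>

fun add_children ::
    "('a \<Rightarrow> int \<Rightarrow> 'a list) \<Rightarrow> int \<Rightarrow> 'a list \<Rightarrow> 'a list timed" where
  "add_children grp i [] = do { tick 1; ret [] }"
| "add_children grp i (p # ps) = do {
     tick (1 + length (grp p i));
     cs \<leftarrow> add_children grp i ps;
     ret (p # grp p i @ cs)
   }"

text \<open>The defining property of a \<open>\<lambda>\<close>-point: \<open>C\<close> is a set of vertices of level at least \<open>i\<close>.\<close>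

definition is_lambda_point ::
    "('a \<Rightarrow> 'a \<Rightarrow> real) \<Rightarrow> 'a rooted_tree \<Rightarrow> nat \<Rightarrow> 'a \<Rightarrow> int \<Rightarrow> 'a set \<Rightarrow> 'a \<Rightarrow> bool" where
  "is_lambda_point d T k q i C x \<longleftrightarrow>
     is_arg_min (d q)
       (\<lambda>y. y \<in> C \<and>
          (\<Sum>p \<in> {p \<in> C. d q p \<le> d q y}. card (distinctive_descendants T i p)) \<ge> k) x"

text \<open>Applied with \<open>s = 0\<close> to the \<open>k\<close> nearest points of \<open>C\<close> by increasing distance, this returns the
  first point at which the partial sum of sizes reaches \<open>k\<close>, together with its distance. Further
  points of \<open>C\<close> tied with it only increase the sum in the definition of a \<open>\<lambda>\<close>-point, so the result
  is one; see \<open>scan_sizes_lambda_point\<close>.\<close>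

fun scan_sizes ::
    "'a rooted_tree \<Rightarrow> int \<Rightarrow> nat \<Rightarrow> nat \<Rightarrow> (real \<times> 'a) list \<Rightarrow> (real \<times> 'a) timed" where
  "scan_sizes T i k s [] = None"
| "scan_sizes T i k s (e # es) = do {
     tick 1;
     let s' = s + card (distinctive_descendants T i (snd e));
     if s' \<ge> k then ret e else scan_sizes T i k s' es
   }"

lemma scan_sizes_SomeD:
  assumes "scan_sizes T i k s es = Some (e, t)"
  defines "w \<equiv> \<lambda>e. card (distinctive_descendants T i (snd e))"
  shows "\<exists>xs ys. es = xs @ e # ys \<and> k \<le> s + sum_list (map w xs) + w e \<and>
           (xs \<noteq> [] \<longrightarrow> s + sum_list (map w xs) < k)"
  using assms(1)
proof (induction es arbitrary: s t)
  case (Cons a es)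
  show ?case
  proof (cases "k \<le> s + w a")
    case True
    then have "a = e"
      using Cons.prems by (simp add: timed_bind_def tick_def ret_def w_def)
    then show ?thesis
      using True by (intro exI[of _ "[]"] exI[of _ es]) simp
  next
    case False
    then obtain t' where "scan_sizes T i k (s + w a) es = Some (e, t')"
      using Cons.prems False
      by (cases "scan_sizes T i k (s + w a) es")
        (auto simp: timed_bind_def tick_def w_def)
    then obtain xs ys where "es = xs @ e # ys"
      "k \<le> s + w a + sum_list (map w xs) + w e"
      "xs \<noteq> [] \<longrightarrow> s + w a + sum_list (map w xs) < k"
      using Cons.IH by blast
    then show ?thesis
      using False by (intro exI[of _ "a # xs"] exI[of _ ys]) auto
  qed
qed simp

lemma scan_sizes_lambda_point:
  assumes "finite C"
    and "sorted (map fst es)" and "distinct (map snd es)"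
    and es: "\<forall>e\<in>set es. snd e \<in> C \<and> fst e = d q (snd e)"
    and nearest: "\<forall>p\<in>C - snd ` set es. \<forall>e\<in>set es. fst e \<le> d q p"
    and scan: "scan_sizes T i k 0 es = Some (e, t)"
  shows "is_lambda_point d T k q i C (snd e) \<and> fst e = d q (snd e)"
proof -
  define w where "w = (\<lambda>p. card (distinctive_descendants T i p))"
  obtain xs ys where xs: "es = xs @ e # ys"
    and ge: "k \<le> sum_list (map w (map snd xs)) + w (snd e)"
    and lt: "xs \<noteq> [] \<longrightarrow> sum_list (map w (map snd xs)) < k"
    using scan_sizes_SomeD[OF scan] unfolding w_def by (auto simp: comp_def)
  have sum_xs: "sum_list (map w (map snd xs)) = sum w (snd ` set xs)"
    using \<open>distinct (map snd es)\<close> xs by (subst sum_list_distinct_conv_sum_set) auto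
  have e: "snd e \<in> C" "fst e = d q (snd e)"
    using es xs by auto
  have "sum w (insert (snd e) (snd ` set xs)) \<le> sum w {p \<in> C. d q p \<le> d q (snd e)}"
  proof (rule sum_mono2)
    show "insert (snd e) (snd ` set xs) \<subseteq> {p \<in> C. d q p \<le> d q (snd e)}"
    proof -
      have "\<forall>e'\<in>set xs. fst e' \<le> fst e"
        using \<open>sorted (map fst es)\<close> unfolding xs by (simp add: sorted_append)
      moreover have "\<forall>e'\<in>set xs. snd e' \<in> C \<and> fst e' = d q (snd e')"
        using es unfolding xs by simp
      ultimately show ?thesis
        using e by fastforce
    qed
  qed (use \<open>finite C\<close> in auto)
  moreover have "sum w (insert (snd e) (snd ` set xs)) = w (snd e) + sum w (snd ` set xs)"
    using \<open>distinct (map snd es)\<close> xs by (subst sum.insert) auto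
  ultimately have "k \<le> sum w {p \<in> C. d q p \<le> d q (snd e)}"
    using ge sum_xs by linarith
  moreover have "\<not> k \<le> sum w {p \<in> C. d q p \<le> d q y}"
    if y: "y \<in> C" "d q y < d q (snd e)" for y
  proof -
    have sub: "{p \<in> C. d q p \<le> d q y} \<subseteq> snd ` set xs"
    proof
      fix p assume p: "p \<in> {p \<in> C. d q p \<le> d q y}"
      then have "d q p < fst e"
        using y e by simp
      moreover have "e \<in> set es"
        using xs by simp
      ultimately have "p \<in> snd ` set es"
        using bspec[OF bspec[OF nearest, of p], of e] p by auto
      then obtain e' where e': "e' \<in> set es" "p = snd e'"
        by blast
      then have "fst e' < fst e"
        using bspec[OF es, of e'] \<open>d q p < fst e\<close> by simp
      moreover have "\<forall>e''\<in>set (e # ys). fst e \<le> fst e''"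
        using \<open>sorted (map fst es)\<close> unfolding xs by (simp add: sorted_append)
      ultimately have "e' \<in> set xs"
        using e'(1) unfolding xs by (meson UnE not_less set_append[THEN equalityD1, THEN subsetD])
      then show "p \<in> snd ` set xs"
        using e' by blast
    qed
    then have "xs \<noteq> []"
      using y by auto
    have "sum w {p \<in> C. d q p \<le> d q y} \<le> sum w (snd ` set xs)"
      using sub by (intro sum_mono2) auto
    then show ?thesis
      using lt \<open>xs \<noteq> []\<close> sum_xs by linarith
  qed
  ultimately show ?thesis
    using e unfolding is_lambda_point_def is_arg_min_def w_def by auto
qed

definition entries_within :: "real \<Rightarrow> (real \<times> 'a) list \<Rightarrow> 'a list timed" where
  "entries_within b es = do { tick (length es); ret (map snd (filter (\<lambda>e. fst e \<le> b) es)) }"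

definition max_Next :: "'a rooted_tree \<Rightarrow> int \<Rightarrow> 'a list \<Rightarrow> int timed" where
  "max_Next T i ps = do {
     tick (length ps);
     ret (Max (set (map (\<lambda>a. Next T a i) ps)))
   }"

text \<open>Traversal with a stack. An entry \<open>(p, i)\<close> asks for everything below the children of \<open>p\<close> at
  levels less than \<open>i\<close>; a child reached at level \<open>j\<close> is stacked as \<open>(a, j)\<close>, all of its own children
  having levels less than \<open>j\<close>.\<close>

partial_function (option) traverse ::
    "'a rooted_tree \<Rightarrow> ('a \<Rightarrow> int \<Rightarrow> 'a list) \<Rightarrow> ('a \<times> int) list \<Rightarrow> 'a list \<Rightarrow> 'a list timed" where
  "traverse T grp stack acc =
     (case stack of
        [] \<Rightarrow> do { tick 1; ret acc }
      | e # st \<Rightarrow> do {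
          tick 1;
          let p = fst e;
          let j = Next T p (snd e);
          if j < l_min T then traverse T grp st acc
          else do {
            tick (length (grp p j));
            traverse T grp (map (\<lambda>a. (a, j)) (grp p j) @ (p, j) # st) (grp p j @ acc)
          }
        })"

definition collect_descendants ::
    "'a rooted_tree \<Rightarrow> ('a \<Rightarrow> int \<Rightarrow> 'a list) \<Rightarrow> int \<Rightarrow> 'a list \<Rightarrow> 'a list timed" where
  "collect_descendants T grp i ps = do {
     tick (length ps);
     traverse T grp (map (\<lambda>p. (p, i)) ps) ps
   }"

text \<open>The list \<open>Rp\<close> is the most recently computed set \<open>R\<^bsub>i\<^esub>\<close>, which the pseudocode calls
  \<open>R\<close> at index \<open>i\<^sup>+\<close>.\<close>

partial_function (option) knn_loop ::
    "('a \<Rightarrow> 'a \<Rightarrow> real) \<Rightarrow> 'a rooted_tree \<Rightarrow> ('a \<Rightarrow> int \<Rightarrow> 'a list) \<Rightarrow> 'a \<Rightarrow> nat \<Rightarrow>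
     int \<Rightarrow> 'a list \<Rightarrow> 'a list timed" where
  "knn_loop d T grp q k i Rp = do {
     tick 1;
     if i < l_min T then output_nearest d q k Rp
     else do {
       C \<leftarrow> add_children grp i Rp;
       es \<leftarrow> with_distances d q C;
       sel \<leftarrow> select_nearest k es;
       e \<leftarrow> scan_sizes T i k 0 sel;
       Ri \<leftarrow> entries_within (fst e + 2 powi (i + 2)) es;
       if fst e > 2 powi (i + 2) then do {
         S \<leftarrow> collect_descendants T grp i Ri;
         output_nearest d q k S
       }
       else do {
         j \<leftarrow> max_Next T i Ri;
         knn_loop d T grp q k j Ri
       }
     }
   }"

definition knn ::
    "('a \<Rightarrow> 'a \<Rightarrow> real) \<Rightarrow> 'a rooted_tree \<Rightarrow> ('a \<Rightarrow> int \<Rightarrow> 'a list) \<Rightarrow> 'a \<Rightarrow> nat \<Rightarrow> 'a list timed" where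
  "knn d T grp q k = do {
     tick 1;
     if verts T = {root_of T} then ret [root_of T]
     else knn_loop d T grp q k (l_max T - 1) [root_of T]
   }"


section \<open>The time bound\<close>

definition log_factor :: "real \<Rightarrow> real" where
  "log_factor x = max 1 (log 2 x)"

text \<open>The constant of the bound has to be the same for all metric spaces. As the type of points is
  quantified outside of a HOL statement, an existentially quantified constant could still depend on
  that type, so a (deliberately generous) numerical value is used instead.\<close>

definition time_constant :: real where
  "time_constant = 10 ^ 6"

end

theory Submission
  imports Defs "HOL-Library.Tree_Multiset"
begin

text \<open>Write \<open>c\<close> for the expansion constant of \<open>R \<union> {q}\<close> and \<open>c\<^sub>m\<close> for the minimized expansion constant
  of \<open>R\<close>. The sets \<open>S\<^sub>i(p)\<close>, for \<open>p\<close> of level at least \<open>i\<close>, partition \<open>R\<close>, and \<open>S\<^sub>i(p)\<close> lies within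
  distance \<open>2\<^sup>i\<^sup>+\<^sup>1\<close> of \<open>p\<close>. The \<open>k\<close> descendants counted by the \<open>\<lambda>\<close>-point therefore show
  \<open>d\<^sub>k \<le> d(q, \<lambda>) + 2\<^sup>i\<^sup>+\<^sup>1\<close>, and every point of \<open>NN\<^sub>k(q; R)\<close> stays in some \<open>S\<^sub>i(p)\<close> with
  \<open>d(q, p) \<le> d(q, \<lambda>) + 2\<^sup>i\<^sup>+\<^sup>2\<close>, which is the pruning radius.

  As long as the search goes on, \<open>R\<^sub>i\<close> is \<open>2\<^sup>i\<close>-separated and lies in a ball of radius \<open>2\<^sup>i\<^sup>+\<^sup>3\<close>, so
  packing gives at most \<open>c\<^sub>m\<^sup>6\<close> points. Each of them has, together with itself, at most \<open>c\<^sub>m\<^sup>4\<close>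
  children of a given level. When the search stops early, fewer than \<open>k\<close> points of \<open>R\<close> lie
  within \<open>d(q, \<lambda>) / 2\<close> of \<open>q\<close> while all collected points lie within \<open>4 d(q, \<lambda>)\<close>, so at most \<open>c\<^sup>3 k\<close> points are collected.

  If iteration \<open>i\<close> is followed by iteration \<open>j\<close>, then some point of \<open>R\<close> has a distance from \<open>q\<close>
  between \<open>2\<^sup>j\<^sup>-\<^sup>1\<close> and \<open>2\<^sup>i\<^sup>+\<^sup>3\<close>. A ball around it is disjoint from a smaller
  ball around \<open>q\<close>, which makes the number of points in balls around \<open>q\<close> grow by a factor
  \<open>1 + 1 / c\<^sup>2\<close> between the scales
  \<open>2\<^sup>j\<^sup>-\<^sup>3\<close> and \<open>2\<^sup>i\<^sup>+\<^sup>4\<close>. Hence there are only \<open>O(c\<^sup>2 log |R|)\<close> iterations.\<close>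


section \<open>Expansion constants\<close>

text \<open>\<open>LEAST\<close> over the reals says nothing unless a minimum is attained.
  Closedness puts the infimum into the set, which makes the inequality in
  \<open>expansion_constant\<close> available for the constant itself.\<close>

lemma Least_real_closed:
  fixes A :: "real set"
  assumes "closed A" "A \<noteq> {}" "bdd_below A"
  shows "(LEAST c. c \<in> A) \<in> A"
proof -
  have "Inf A \<in> A" using closed_contains_Inf assms by blast
  moreover have "(LEAST c. c \<in> A) = Inf A"
    by (rule Least_equality) (use assms calculation in \<open>auto intro: cInf_lower\<close>)
  ultimately show ?thesis by simp
qed

text \<open>\<open>Lim\<close> is a description operator, so a limit has to be exhibited before it
  can be used. For an antitone function the supremum is the limit from the right.\<close>

lemma tendsto_SUP_at_right:
  fixes f :: "real \<Rightarrow> ereal"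
  assumes anti: "\<And>x y. a < x \<Longrightarrow> x \<le> y \<Longrightarrow> f y \<le> f x"
  shows "(f \<longlongrightarrow> (SUP x\<in>{a<..}. f x)) (at_right a)"
proof (rule order_tendstoI)
  fix b assume "b < (SUP x\<in>{a<..}. f x)"
  then obtain x where x: "x > a" "b < f x" by (auto simp: less_SUP_iff)
  have "\<forall>\<^sub>F y in at_right a. y < x \<and> a < y"
    using x(1) by (auto simp: eventually_at_right)
  then show "\<forall>\<^sub>F y in at_right a. b < f y"
    by eventually_elim (use x anti in \<open>meson less_le_trans less_imp_le\<close>)
next
  fix b assume b: "(SUP x\<in>{a<..}. f x) < b"
  have "\<forall>\<^sub>F y in at_right a. a < y" by (simp add: eventually_at_right_less)
  then show "\<forall>\<^sub>F y in at_right a. f y < b"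
    by eventually_elim (use b in \<open>meson SUP_upper greaterThan_iff le_less_trans\<close>)
qed

context Metric_space
begin

lemma expansion_constant_props:
  assumes "finite S" "S \<subseteq> M"
  shows expansion_constant_ge_2: "expansion_constant S \<ge> 2"
    and card_mcball_double: "\<And>p t. p \<in> S \<Longrightarrow> t \<ge> 0 \<Longrightarrow>
      real (card (mcball p (2 * t) \<inter> S)) \<le> expansion_constant S * real (card (mcball p t \<inter> S))"
proof -
  define A where "A = {c. c \<ge> 2 \<and>
        (\<forall>p\<in>S. \<forall>t\<ge>0. real (card (mcball p (2 * t) \<inter> S)) \<le> c * real (card (mcball p t \<inter> S)))}"
  \<comment> \<open>An intersection of closed conditions on \<open>c\<close>, one for each center
    and radius, hence closed.\<close>
  have "A = {2..} \<inter> (\<Inter>p\<in>S. \<Inter>t\<in>{0..}.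
      {c. real (card (mcball p (2 * t) \<inter> S)) \<le> c * real (card (mcball p t \<inter> S))})"
    unfolding A_def by auto
  moreover have "closed {c. a \<le> c * b}" for a b :: real
    by (intro closed_Collect_le continuous_intros)
  ultimately have "closed A"
    by (simp only:) (intro closed_Int closed_atLeast closed_INT ballI)
  \<comment> \<open>An admissible constant: a ball about \<open>p \<in> S\<close> contains
    \<open>p\<close>, so its count is at least 1, and no count exceeds
    \<open>card S\<close>.\<close>
  have "max 2 (real (card S)) \<in> A"
  proof -
    have "real (card (mcball p (2 * t) \<inter> S)) \<le> max 2 (real (card S)) * real (card (mcball p t \<inter> S))"
      if "p \<in> S" "t \<ge> 0" for p t
    proof -
      have "p \<in> mcball p t \<inter> S" using that assms by (auto simp: mcball_def)
      then have "1 \<le> card (mcball p t \<inter> S)"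
        using assms by (metis One_nat_def Suc_leI card_gt_0_iff empty_iff finite_Int)
      moreover have "card (mcball p (2 * t) \<inter> S) \<le> card S" using assms by (intro card_mono) auto
      ultimately have "real (card (mcball p (2 * t) \<inter> S)) * 1
          \<le> max 2 (real (card S)) * real (card (mcball p t \<inter> S))"
        by (intro mult_mono) auto
      then show ?thesis by simp
    qed
    then show ?thesis unfolding A_def by auto
  qed
  then have "A \<noteq> {}" by blast
  have "bdd_below A" by (rule bdd_belowI[of _ 2]) (auto simp: A_def)
  have "expansion_constant S \<in> A"
    using Least_real_closed[OF \<open>closed A\<close> \<open>A \<noteq> {}\<close> \<open>bdd_below A\<close>]
    unfolding expansion_constant_def A_def by simp
  then show "expansion_constant S \<ge> 2"
    "\<And>p t. p \<in> S \<Longrightarrow> t \<ge> 0 \<Longrightarrow>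
      real (card (mcball p (2 * t) \<inter> S)) \<le> expansion_constant S * real (card (mcball p t \<inter> S))"
    unfolding A_def by auto
qed

lemma card_mcball_power:
  assumes "finite S" "S \<subseteq> M" "p \<in> S" "t \<ge> 0"
  shows "real (card (mcball p (2 ^ n * t) \<inter> S)) \<le> expansion_constant S ^ n * real (card (mcball p t \<inter> S))"
proof (induction n)
  case (Suc n)
  have "real (card (mcball p (2 ^ Suc n * t) \<inter> S))
      \<le> expansion_constant S * real (card (mcball p (2 ^ n * t) \<inter> S))"
    using card_mcball_double[OF assms(1-3), of "2 ^ n * t"] assms(4) by (simp add: mult.assoc)
  also have "\<dots> \<le> expansion_constant S * (expansion_constant S ^ n * real (card (mcball p t \<inter> S)))"
    using Suc expansion_constant_ge_2[OF assms(1,2)] by (intro mult_left_mono) auto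
  finally show ?case by (simp add: mult.assoc)
qed simp

text \<open>The balls of radius \<open>r\<close> about \<open>q\<close> and \<open>x\<close> are
  disjoint and both lie in the ball of radius \<open>4 * r\<close> about \<open>q\<close>. The first
  one also lies in the ball of radius \<open>4 * r\<close> about \<open>x\<close>, so two doublings
  at \<open>x\<close> show that the second one holds at least a fraction
  \<open>1 / expansion_constant S ^ 2\<close> of its count.\<close>

lemma card_mcball_growth:
  assumes "finite S" "S \<subseteq> M" "x \<in> S" "q \<in> M" "d q x = 3 * r" "r > 0"
  shows "(1 + 1 / expansion_constant S ^ 2) * real (card (mcball q r \<inter> S))
    \<le> real (card (mcball q (4 * r) \<inter> S))"
proof -
  let ?c = "expansion_constant S"
  have c: "?c > 0" using expansion_constant_ge_2[OF assms(1,2)] by simp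
  have "x \<in> M" using assms by auto
  have d: "d x q = 3 * r" using assms commute by metis
  have "mcball q r \<inter> S \<subseteq> mcball x (2 ^ 2 * r) \<inter> S"
  proof
    fix y assume y: "y \<in> mcball q r \<inter> S"
    then have "d x y \<le> d x q + d q y" using assms \<open>x \<in> M\<close> by (intro triangle) auto
    then show "y \<in> mcball x (2 ^ 2 * r) \<inter> S" using y d \<open>x \<in> M\<close> by (auto simp: mcball_def)
  qed
  then have "real (card (mcball q r \<inter> S)) \<le> real (card (mcball x (2 ^ 2 * r) \<inter> S))"
    using assms by (simp add: card_mono)
  also have "\<dots> \<le> ?c ^ 2 * real (card (mcball x r \<inter> S))"
    using card_mcball_power[OF assms(1-3), of r 2] assms by simp
  finally have 1: "real (card (mcball q r \<inter> S)) / ?c ^ 2 \<le> real (card (mcball x r \<inter> S))"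
    using c by (simp add: field_simps)
  have disj: "(mcball q r \<inter> S) \<inter> (mcball x r \<inter> S) = {}"
  proof (rule ccontr)
    assume "\<not> ?thesis"
    then obtain y where y: "y \<in> mcball q r" "y \<in> mcball x r" by blast
    then have "d q x \<le> d q y + d x y" using assms \<open>x \<in> M\<close> by (intro triangle') auto
    then show False using y assms by auto
  qed
  have "(mcball q r \<inter> S) \<union> (mcball x r \<inter> S) \<subseteq> mcball q (4 * r) \<inter> S"
  proof
    fix y assume y: "y \<in> (mcball q r \<inter> S) \<union> (mcball x r \<inter> S)"
    moreover have "d q y \<le> d q x + d x y" using assms \<open>x \<in> M\<close> y by (intro triangle) auto
    ultimately show "y \<in> mcball q (4 * r) \<inter> S" using assms by (auto simp: mcball_def)
  qed
  then have "card ((mcball q r \<inter> S) \<union> (mcball x r \<inter> S)) \<le> card (mcball q (4 * r) \<inter> S)"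
    using assms by (intro card_mono) auto
  then have "card (mcball q r \<inter> S) + card (mcball x r \<inter> S) \<le> card (mcball q (4 * r) \<inter> S)"
    using card_Un_disjoint[OF _ _ disj] assms by simp
  then have "real (card (mcball q r \<inter> S)) + real (card (mcball x r \<inter> S)) \<le> real (card (mcball q (4 * r) \<inter> S))"
    by linarith
  then show ?thesis using 1 by (simp add: algebra_simps)
qed

section \<open>The minimized expansion constant as a monotone limit\<close>

definition expansion_beyond :: "'a set \<Rightarrow> real \<Rightarrow> ereal" where
  "expansion_beyond A \<xi> = (SUP (p, t) \<in> A \<times> {\<xi><..}.
     ereal (real (card (mcball p (2 * t) \<inter> A)) / real (card (mcball p t \<inter> A))))"

text \<open>This and \<open>expansion_beyond\<close> name the inner layers of
  \<open>minimized_expansion_constant\<close>, so that the outer limit concerns a single antitone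
  function of \<xi>.\<close>

definition min_expansion_beyond :: "'a set \<Rightarrow> real \<Rightarrow> ereal" where
  "min_expansion_beyond S \<xi> =
     (INF A \<in> {A. S \<subseteq> A \<and> A \<subseteq> M \<and> locally_finite_set A}. expansion_beyond A \<xi>)"

lemma min_expansion_beyond_antimono:
  "x \<le> y \<Longrightarrow> min_expansion_beyond S y \<le> min_expansion_beyond S x"
  unfolding min_expansion_beyond_def
proof (rule INF_mono)
  fix A assume xy: "x \<le> y" and A: "A \<in> {A. S \<subseteq> A \<and> A \<subseteq> M \<and> locally_finite_set A}"
  have "A \<times> {y<..} \<subseteq> A \<times> {x<..}" using xy by auto
  then have "expansion_beyond A y \<le> expansion_beyond A x"
    unfolding expansion_beyond_def by (rule SUP_subset_mono) simp
  then show "\<exists>B \<in> {A. S \<subseteq> A \<and> A \<subseteq> M \<and> locally_finite_set A}.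
      expansion_beyond B y \<le> expansion_beyond A x"
    using A by blast
qed

lemma card_mcball_pos:
  assumes "locally_finite_set A" "A \<subseteq> M" "p \<in> A" "t \<ge> 0"
  shows "card (mcball p t \<inter> A) > 0"
proof -
  have "finite (mcball p t \<inter> A)" "p \<in> mcball p t \<inter> A"
    using assms by (auto simp: locally_finite_set_def mcball_def)
  then show ?thesis using card_gt_0_iff by blast
qed

text \<open>Together with the upper bound \<open>card S\<close>, obtained from the choice
  \<open>A = S\<close>, this keeps the limit finite, so that \<open>real_of_ereal\<close> preserves
  its value.\<close>

lemma min_expansion_beyond_ge_1:
  assumes "S \<noteq> {}" "\<xi> > 0"
  shows "1 \<le> min_expansion_beyond S \<xi>"
  unfolding min_expansion_beyond_def
proof (intro INF_greatest)
  fix A assume A: "A \<in> {A. S \<subseteq> A \<and> A \<subseteq> M \<and> locally_finite_set A}"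
  then obtain p where p: "p \<in> A" using assms by auto
  define t where "t = \<xi> + 1"
  have fin: "finite (mcball p (2 * t) \<inter> A)"
    using A p assms unfolding t_def locally_finite_set_def by auto
  have "mcball p t \<subseteq> mcball p (2 * t)" unfolding t_def mcball_def using assms by auto
  then have "card (mcball p t \<inter> A) \<le> card (mcball p (2 * t) \<inter> A)"
    using fin by (intro card_mono) auto
  moreover have "card (mcball p t \<inter> A) > 0"
    using card_mcball_pos A p assms unfolding t_def by auto
  ultimately have "1 \<le> ereal (real (card (mcball p (2 * t) \<inter> A)) / real (card (mcball p t \<inter> A)))"
    by simp
  also have "\<dots> \<le> expansion_beyond A \<xi>"
    unfolding expansion_beyond_def
    by (rule SUP_upper2[of "(p, t)"]) (auto simp: p t_def)
  finally show "1 \<le> expansion_beyond A \<xi>" .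
qed

lemma min_expansion_beyond_le_card:
  assumes "finite S" "S \<subseteq> M" "\<xi> > 0"
  shows "min_expansion_beyond S \<xi> \<le> ereal (card S)"
proof -
  have lf: "locally_finite_set S" using assms by (simp add: locally_finite_set_def)
  have "min_expansion_beyond S \<xi> \<le> expansion_beyond S \<xi>"
    unfolding min_expansion_beyond_def using assms lf by (intro INF_lower) auto
  also have "\<dots> \<le> ereal (card S)"
    unfolding expansion_beyond_def
  proof (intro SUP_least, clarify)
    fix p t assume "p \<in> S" "t > \<xi>"
    then have "card (mcball p t \<inter> S) > 0" using card_mcball_pos lf assms by auto
    moreover have "card (mcball p (2 * t) \<inter> S) \<le> card S" using assms by (intro card_mono) auto
    ultimately have "real (card (mcball p (2 * t) \<inter> S)) * 1 \<le> real (card S) * real (card (mcball p t \<inter> S))"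
      by (intro mult_mono) auto
    then show "ereal (real (card (mcball p (2 * t) \<inter> S)) / real (card (mcball p t \<inter> S))) \<le> ereal (card S)"
      using \<open>card (mcball p t \<inter> S) > 0\<close> by (simp add: divide_le_eq)
  qed
  finally show ?thesis .
qed

text \<open>By antitonicity the limit at 0 is the supremum over all positive \<xi> and so bounds
  each single value. The scale \<xi> can therefore be chosen freely in applications.\<close>

lemma minimized_expansion_constant_props:
  assumes "finite S" "S \<subseteq> M" "S \<noteq> {}"
  shows minimized_expansion_constant_ge_1: "1 \<le> minimized_expansion_constant S"
    and min_expansion_beyond_le: "\<xi> > 0 \<Longrightarrow>
      min_expansion_beyond S \<xi> \<le> ereal (minimized_expansion_constant S)"
proof -
  define L where "L = (SUP \<xi>\<in>{0<..}. min_expansion_beyond S \<xi>)"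
  have "(min_expansion_beyond S \<longlongrightarrow> L) (at_right 0)"
    unfolding L_def by (rule tendsto_SUP_at_right) (rule min_expansion_beyond_antimono)
  then have "Lim (at_right 0) (min_expansion_beyond S) = L"
    by (intro tendsto_Lim) auto
  then have eq: "minimized_expansion_constant S = real_of_ereal L"
    unfolding minimized_expansion_constant_def min_expansion_beyond_def expansion_beyond_def by simp
  have "L \<le> ereal (card S)"
    unfolding L_def using min_expansion_beyond_le_card assms by (intro SUP_least) auto
  have up: "min_expansion_beyond S \<xi> \<le> L" if "\<xi> > 0" for \<xi>
    unfolding L_def using that by (intro SUP_upper) auto
  then have "1 \<le> L" using min_expansion_beyond_ge_1[of S 1] assms order_trans by force
  then have L: "ereal (real_of_ereal L) = L"
    using \<open>L \<le> ereal (card S)\<close> by (cases L) auto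
  then show "1 \<le> minimized_expansion_constant S"
    using \<open>1 \<le> L\<close> eq by (metis ereal_less_eq(3) one_ereal_def)
  show "\<xi> > 0 \<Longrightarrow> min_expansion_beyond S \<xi> \<le> ereal (minimized_expansion_constant S)"
    using up L eq by simp
qed

text \<open>A volume argument that counts points of \<open>A\<close>. The balls of radius
  \<open>\<delta> / 2\<close> about the points of \<open>S'\<close> are pairwise disjoint, and all
  of them lie within \<open>2 * t + \<delta> / 2\<close> of any point of \<open>S'\<close>. The
  condition on \<open>n\<close> says that \<open>n\<close> doublings of \<open>\<delta> / 2\<close>
  reach this radius.\<close>

lemma card_separated_le_of_doubling:
  assumes A: "A \<subseteq> M" "locally_finite_set A" and b: "b \<ge> 0"
    and exp: "\<And>p t. p \<in> A \<Longrightarrow> t > \<xi> \<Longrightarrow>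
      real (card (mcball p (2 * t) \<inter> A)) \<le> b * real (card (mcball p t \<inter> A))"
    and sub: "S' \<subseteq> A" "S' \<subseteq> mcball q t" and fin: "finite S'"
    and \<delta>: "\<delta> > 0" "\<xi> < \<delta> / 2"
    and sep: "\<And>x y. x \<in> S' \<Longrightarrow> y \<in> S' \<Longrightarrow> x \<noteq> y \<Longrightarrow> d x y > \<delta>"
    and n: "2 ^ n * \<delta> \<ge> 4 * t + \<delta>"
  shows "real (card S') \<le> b ^ n"
proof (cases "S' = {}")
  case False
  let ?N = "\<lambda>x r. card (mcball x r \<inter> A)"
  \<comment> \<open>The center whose small ball has the fewest points: the disjoint balls together
    hold at least \<open>card S'\<close> times as many, and dividing by this count gives the
    bound.\<close>
  define x where "x = arg_min_on (\<lambda>x. ?N x (\<delta> / 2)) S'"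
  have x: "x \<in> S'" "\<And>y. y \<in> S' \<Longrightarrow> ?N x (\<delta> / 2) \<le> ?N y (\<delta> / 2)"
    unfolding x_def using arg_min_if_finite(1)[OF fin False] arg_min_least[OF fin False] by auto
  have S'M: "S' \<subseteq> M" using sub A by auto
  have q: "q \<in> M" and dqx: "\<And>y. y \<in> S' \<Longrightarrow> d q y \<le> t" using sub x by auto
  have t: "t \<ge> 0" using dqx[OF x(1)] nonneg order_trans by blast
  have fin_ball: "finite (mcball y r \<inter> A)" if "y \<in> M" for y r
  proof (cases "r \<ge> 0")
    case False
    then have "mcball y r = {}" by (simp add: mcball_eq_empty)
    then show ?thesis by simp
  qed (use A that in \<open>auto simp: locally_finite_set_def\<close>)
  \<comment> \<open>All radii doubled here are at least \<open>\<delta> / 2\<close>, hence above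
    \<xi>, where the doubling bound is available.\<close>
  have pow: "real (?N x (2 ^ m * (\<delta> / 2))) \<le> b ^ m * real (?N x (\<delta> / 2))" for m
  proof (induction m)
    case (Suc m)
    have "1 * (\<delta> / 2) \<le> 2 ^ m * (\<delta> / 2)" using \<delta> by (intro mult_right_mono) auto
    then have "\<xi> < 2 ^ m * (\<delta> / 2)" using \<delta> by linarith
    then have "real (?N x (2 * (2 ^ m * (\<delta> / 2)))) \<le> b * real (?N x (2 ^ m * (\<delta> / 2)))"
      using x sub by (intro exp) auto
    also have "\<dots> \<le> b * (b ^ m * real (?N x (\<delta> / 2)))" using b Suc by (intro mult_left_mono)
    finally show ?case by (simp add: mult.assoc)
  qed simp
  have "card (\<Union>y\<in>S'. mcball y (\<delta> / 2) \<inter> A) = (\<Sum>y\<in>S'. ?N y (\<delta> / 2))"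
  proof (rule card_UN_disjoint[OF fin])
    show "\<forall>y\<in>S'. finite (mcball y (\<delta> / 2) \<inter> A)" using fin_ball S'M by auto
    show "\<forall>y\<in>S'. \<forall>z\<in>S'. y \<noteq> z \<longrightarrow> mcball y (\<delta> / 2) \<inter> A \<inter> (mcball z (\<delta> / 2) \<inter> A) = {}"
    proof (intro ballI impI)
      fix y z assume yz: "y \<in> S'" "z \<in> S'" "y \<noteq> z"
      have False if "w \<in> mcball y (\<delta> / 2)" "w \<in> mcball z (\<delta> / 2)" for w
        using triangle'[of y w z] that sep[OF yz] by auto
      then show "mcball y (\<delta> / 2) \<inter> A \<inter> (mcball z (\<delta> / 2) \<inter> A) = {}" by blast
    qed
  qed
  moreover have "card (\<Union>y\<in>S'. mcball y (\<delta> / 2) \<inter> A) \<le> ?N x (2 ^ n * (\<delta> / 2))"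
  proof (rule card_mono[OF fin_ball])
    show "(\<Union>y\<in>S'. mcball y (\<delta> / 2) \<inter> A) \<subseteq> mcball x (2 ^ n * (\<delta> / 2)) \<inter> A"
    proof
      fix w assume "w \<in> (\<Union>y\<in>S'. mcball y (\<delta> / 2) \<inter> A)"
      then obtain y where y: "y \<in> S'" and w: "w \<in> mcball y (\<delta> / 2)" "w \<in> A" by blast
      have M: "x \<in> M" "y \<in> M" "w \<in> M" using S'M x y w by auto
      have "d x w \<le> d x y + d y w" "d x y \<le> d q x + d q y"
        using M q triangle triangle'' by auto
      then have "d x w \<le> t + t + \<delta> / 2" using dqx[OF x(1)] dqx[OF y] w by auto
      then show "w \<in> mcball x (2 ^ n * (\<delta> / 2)) \<inter> A" using M w n by auto
    qed
  qed (use x S'M in auto)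
  moreover have "card S' * ?N x (\<delta> / 2) \<le> (\<Sum>y\<in>S'. ?N y (\<delta> / 2))"
    using sum_bounded_below[of S' "?N x (\<delta> / 2)" "\<lambda>y. ?N y (\<delta> / 2)"] x by simp
  ultimately have "real (card S' * ?N x (\<delta> / 2)) \<le> real (?N x (2 ^ n * (\<delta> / 2)))"
    by linarith
  also have "\<dots> \<le> b ^ n * real (?N x (\<delta> / 2))" by (rule pow)
  finally have "real (card S') * real (?N x (\<delta> / 2)) \<le> b ^ n * real (?N x (\<delta> / 2))" by simp
  moreover have "?N x (\<delta> / 2) > 0" using card_mcball_pos A x sub \<delta> by auto
  ultimately show ?thesis by simp
qed (use b in simp)

text \<open>The infimum over \<open>A\<close> need not be attained. For each positive \<epsilon>, a
  set \<open>A\<close> whose ratios beyond the scale \<open>\<delta> / 4\<close> stay below the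
  constant plus \<epsilon> gives the packing bound up to \<epsilon>, and then \<epsilon> tends to
  0.\<close>

lemma card_separated_le:
  assumes S: "finite S" "S \<subseteq> M" "S \<noteq> {}" and sub: "S' \<subseteq> S" "S' \<subseteq> mcball q t" and \<delta>: "\<delta> > 0"
    and sep: "\<And>x y. x \<in> S' \<Longrightarrow> y \<in> S' \<Longrightarrow> x \<noteq> y \<Longrightarrow> d x y > \<delta>"
    and n: "2 ^ n * \<delta> \<ge> 4 * t + \<delta>"
  shows "real (card S') \<le> minimized_expansion_constant S ^ n"
proof -
  let ?c = "minimized_expansion_constant S"
  have c: "?c \<ge> 1" using minimized_expansion_constant_ge_1 S by blast
  have "real (card S') \<le> (?c + \<epsilon>) ^ n" if "\<epsilon> > 0" for \<epsilon>
  proof -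
    have "min_expansion_beyond S (\<delta> / 4) < ereal (?c + \<epsilon>)"
      using min_expansion_beyond_le[OF S, of "\<delta> / 4"] \<delta> that
      by (metis add_less_cancel_left add_0_right divide_pos_pos ereal_less(3) le_less_trans less_ereal.simps(1) zero_less_numeral)
    then obtain A where A: "S \<subseteq> A" "A \<subseteq> M" "locally_finite_set A"
      and less: "expansion_beyond A (\<delta> / 4) < ereal (?c + \<epsilon>)"
      unfolding min_expansion_beyond_def INF_less_iff by auto
    show ?thesis
    proof (rule card_separated_le_of_doubling[OF A(2,3)])
      fix p t assume p: "p \<in> A" "\<delta> / 4 < t"
      have "ereal (real (card (mcball p (2 * t) \<inter> A)) / real (card (mcball p t \<inter> A)))
          \<le> expansion_beyond A (\<delta> / 4)"
        unfolding expansion_beyond_def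
        by (rule SUP_upper2[of "(p, t)"]) (use p in auto)
      then have "real (card (mcball p (2 * t) \<inter> A)) / real (card (mcball p t \<inter> A)) < ?c + \<epsilon>"
        using less by (metis le_less_trans less_ereal.simps(1))
      then show "real (card (mcball p (2 * t) \<inter> A)) \<le> (?c + \<epsilon>) * real (card (mcball p t \<inter> A))"
        using card_mcball_pos[OF A(3,2) p(1), of t] p \<delta> by (simp add: divide_less_eq)
    qed (use A sub \<delta> sep n that c S in \<open>auto intro: finite_subset\<close>)
  qed
  then have "\<forall>\<^sub>F \<epsilon> in at_right 0. real (card S') \<le> (?c + \<epsilon>) ^ n"
    by (simp add: eventually_at_right_less eventually_mono[OF eventually_at_right_less])
  moreover have "((\<lambda>\<epsilon>. (?c + \<epsilon>) ^ n) \<longlongrightarrow> (?c + 0) ^ n) (at_right 0)"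
    by (intro tendsto_intros)
  ultimately show ?thesis
    using tendsto_lowerbound[of "\<lambda>\<epsilon>. (?c + \<epsilon>) ^ n" "(?c + 0) ^ n" "at_right 0"] by simp
qed

end


section \<open>Computations with a cost counter\<close>

text \<open>A total correctness triple: termination, a cost bound and a postcondition at once. Cost
  bounds add up along \<open>timed_bind\<close>, so programs are verified by composing these
  triples.\<close>

definition runs_within :: "'b timed \<Rightarrow> nat \<Rightarrow> ('b \<Rightarrow> bool) \<Rightarrow> bool" where
  "runs_within m n Q \<longleftrightarrow> (\<exists>x t. m = Some (x, t) \<and> t \<le> n \<and> Q x)"

lemma runs_within_ret [intro]: "Q x \<Longrightarrow> runs_within (ret x) n Q"
  by (simp add: runs_within_def ret_def)

lemma runs_within_bind:
  assumes "runs_within m n P" "\<And>x. P x \<Longrightarrow> runs_within (f x) n' Q"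
  shows "runs_within (timed_bind m f) (n + n') Q"
  using assms unfolding runs_within_def timed_bind_def by fastforce

lemma runs_within_tick:
  assumes "runs_within m n Q" "k + n \<le> n'"
  shows "runs_within (timed_bind (tick k) (\<lambda>_. m)) n' Q"
  using assms unfolding runs_within_def timed_bind_def tick_def by fastforce

lemma runs_within_mono:
  assumes "runs_within m n P" "n \<le> n'" "\<And>x. P x \<Longrightarrow> Q x"
  shows "runs_within m n' Q"
  using assms unfolding runs_within_def by fastforce


section \<open>Heaps in the shape of Braun trees\<close>

fun braun :: "'b tree \<Rightarrow> bool" where
  "braun \<langle>\<rangle> \<longleftrightarrow> True"
| "braun \<langle>l, x, r\<rangle> \<longleftrightarrow> (size l = size r \<or> size l = Suc (size r)) \<and> braun l \<and> braun r"

fun max_heap :: "(real \<times> 'b) tree \<Rightarrow> bool" where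
  "max_heap \<langle>\<rangle> \<longleftrightarrow> True"
| "max_heap \<langle>l, x, r\<rangle> \<longleftrightarrow> (\<forall>y \<in> set_tree l \<union> set_tree r. fst y \<le> fst x) \<and> max_heap l \<and> max_heap r"

text \<open>The left subtree is the larger one, so both subtrees have \<open>2 ^ height\<close> at
  most twice its size, and the whole tree has at least twice as many nodes as it.\<close>

lemma braun_height: "braun t \<Longrightarrow> t \<noteq> \<langle>\<rangle> \<Longrightarrow> 2 ^ height t \<le> 2 * size t"
proof (induction t)
  case (Node l x r)
  show ?case
  proof (cases "l = \<langle>\<rangle>")
    case True
    then show ?thesis using Node.prems by auto
  next
    case False
    then have "size l > 0" by (cases l) auto
    have l: "2 ^ height l \<le> 2 * size l" using Node False by auto
    have r: "2 ^ height r \<le> 2 * size l"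
    proof (cases "r = \<langle>\<rangle>")
      case True
      then show ?thesis using \<open>size l > 0\<close> by simp
    next
      case False
      then have "2 ^ height r \<le> 2 * size r" using Node by auto
      then show ?thesis using Node.prems by auto
    qed
    have "(2::nat) ^ max (height l) (height r) \<le> 2 * size l"
      using l r by (simp add: max_def)
    then show ?thesis using Node.prems by auto
  qed
qed simp

text \<open>For \<open>k \<ge> 1\<close> this is 1 plus the rounded-down binary logarithm of
  \<open>k\<close>. It is a natural number because costs are counted in \<open>nat\<close>.\<close>

definition heap_height_bound :: "nat \<Rightarrow> nat" where
  "heap_height_bound k = nat \<lfloor>log 2 (2 * real k)\<rfloor>"

lemma height_le_heap_height_bound:
  assumes "braun t" "size t \<le> k"
  shows "height t \<le> heap_height_bound k"
proof (cases "t = \<langle>\<rangle>")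
  case False
  then have "2 ^ height t \<le> 2 * size t" using braun_height assms by blast
  then have "2 ^ height t \<le> 2 * k" using assms by linarith
  then have "2 ^ height t \<le> 2 * real k"
    by (metis of_nat_le_iff of_nat_mult of_nat_numeral of_nat_power)
  then have "log 2 (2 ^ height t) \<le> log 2 (2 * real k)"
    by (intro log_mono) auto
  then have "real (height t) \<le> log 2 (2 * real k)" by simp
  then show ?thesis
    unfolding heap_height_bound_def by (simp add: le_nat_floor)
qed simp

lemma heap_height_bound_ge: "1 \<le> k \<Longrightarrow> 1 \<le> heap_height_bound k"
  using height_le_heap_height_bound[of "\<langle>\<langle>\<rangle>, (), \<langle>\<rangle>\<rangle>" k] by simp

lemma heap_height_bound_log_factor:
  assumes "1 \<le> k"
  shows "real (heap_height_bound k) \<le> 2 * log_factor k"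
proof -
  have "0 \<le> log 2 (2 * real k)" using assms by simp
  then have "real (heap_height_bound k) \<le> log 2 (2 * real k)"
    unfolding heap_height_bound_def by simp
  also have "\<dots> = 1 + log 2 k" using assms by (simp add: log_mult)
  finally show ?thesis unfolding log_factor_def by simp
qed

text \<open>Insertion goes into the right subtree, which then becomes the left one. Its new size
  \<open>Suc (size r)\<close> equals the size of the old left subtree or exceeds it by one, so the
  Braun shape survives.\<close>

lemma heap_insert_correct:
  "braun h \<Longrightarrow> max_heap h \<Longrightarrow>
   runs_within (heap_insert x h) (Suc (height h))
     (\<lambda>h'. braun h' \<and> max_heap h' \<and> mset_tree h' = add_mset x (mset_tree h))"
proof (induction x h rule: heap_insert.induct)
  case (1 x)
  show ?case by (auto intro!: runs_within_tick[where n = 0])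
next
  case (2 x l y r)
  \<comment> \<open>Sizes and element sets can be read off from the multiset equation, so
    postconditions only need to carry the latter.\<close>
  have *: "size h' = Suc (size r)" "set_tree h' = insert z (set_tree r)"
    if "mset_tree h' = add_mset z (mset_tree r)" for h' z
    using arg_cong[OF that, of size] arg_cong[OF that, of set_mset] by auto
  show ?case
  proof (cases "fst y < fst x")
    case True
    have IH: "runs_within (heap_insert y r) (Suc (height r))
      (\<lambda>h'. braun h' \<and> max_heap h' \<and> mset_tree h' = add_mset y (mset_tree r))"
      using 2 True by simp
    have "runs_within (timed_bind (heap_insert y r) (\<lambda>r'. ret \<langle>r', x, l\<rangle>)) (Suc (height r) + 0)
     (\<lambda>h'. braun h' \<and> max_heap h' \<and> mset_tree h' = add_mset x (mset_tree \<langle>l, y, r\<rangle>))"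
    proof (rule runs_within_bind[OF IH], elim conjE, rule runs_within_ret)
      fix r' assume r': "braun r'" "max_heap r'" "mset_tree r' = add_mset y (mset_tree r)"
      show "braun \<langle>r', x, l\<rangle> \<and> max_heap \<langle>r', x, l\<rangle> \<and>
          mset_tree \<langle>r', x, l\<rangle> = add_mset x (mset_tree \<langle>l, y, r\<rangle>)"
        using r' *[OF r'(3)] 2(3,4) True by (auto intro: order_trans less_imp_le)
    qed
    then show ?thesis
      using True by (simp add: runs_within_tick)
  next
    case False
    have IH: "runs_within (heap_insert x r) (Suc (height r))
      (\<lambda>h'. braun h' \<and> max_heap h' \<and> mset_tree h' = add_mset x (mset_tree r))"
      using 2 False by simp
    have "runs_within (timed_bind (heap_insert x r) (\<lambda>r'. ret \<langle>r', y, l\<rangle>)) (Suc (height r) + 0)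
     (\<lambda>h'. braun h' \<and> max_heap h' \<and> mset_tree h' = add_mset x (mset_tree \<langle>l, y, r\<rangle>))"
    proof (rule runs_within_bind[OF IH], elim conjE, rule runs_within_ret)
      fix r' assume r': "braun r'" "max_heap r'" "mset_tree r' = add_mset x (mset_tree r)"
      show "braun \<langle>r', y, l\<rangle> \<and> max_heap \<langle>r', y, l\<rangle> \<and>
          mset_tree \<langle>r', y, l\<rangle> = add_mset x (mset_tree \<langle>l, y, r\<rangle>)"
        using r' *[OF r'(3)] 2(3,4) False by (auto intro: order_trans less_imp_le)
    qed
    then show ?thesis
      using False by (simp add: runs_within_tick)
  qed
qed

lemma sift_down_correct:
  "braun \<langle>l, x, r\<rangle> \<Longrightarrow> max_heap l \<Longrightarrow> max_heap r \<Longrightarrow>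
   runs_within (sift_down l x r) (height \<langle>l, x, r\<rangle>)
     (\<lambda>h'. braun h' \<and> max_heap h' \<and> mset_tree h' = mset_tree \<langle>l, x, r\<rangle>)"
proof (induction l x r rule: sift_down.induct)
  case (1 x r)
  then show ?case by (auto intro!: runs_within_tick[where n = 0])
next
  case (2 l1 y r1 x)
  \<comment> \<open>With an empty right subtree the Braun shape leaves at most one node on the left,
    so one comparison finishes.\<close>
  then have "l1 = \<langle>\<rangle>" "r1 = \<langle>\<rangle>" by auto
  with 2 show ?case
    by (auto simp: add_mset_commute intro!: runs_within_tick[where n = 0])
next
  case (3 l1 y r1 x l2 z r2)
  have *: "size h' = Suc (size l + size r)" "set_tree h' = insert x (set_tree l \<union> set_tree r)"
    if "mset_tree h' = add_mset x (mset_tree l + mset_tree r)" for h' x and l r :: "(real \<times> 'a) tree"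
    using arg_cong[OF that, of size] arg_cong[OF that, of set_mset] by auto
  consider (a) "fst y \<le> fst x" "fst z \<le> fst x"
    | (b) "\<not> (fst y \<le> fst x \<and> fst z \<le> fst x)" "fst z \<le> fst y"
    | (c) "\<not> (fst y \<le> fst x \<and> fst z \<le> fst x)" "\<not> fst z \<le> fst y"
    by blast
  then show ?case
  proof cases
    case a
    have "\<forall>w \<in> set_tree l1 \<union> set_tree r1. fst w \<le> fst x"
      "\<forall>w \<in> set_tree l2 \<union> set_tree r2. fst w \<le> fst x"
      using 3(4,5) a by (auto intro: order_trans)
    then show ?thesis
      using a 3(3-5) by (simp, intro runs_within_tick[where n = 0] runs_within_ret) auto
  next
    case b
    have IH: "runs_within (sift_down l1 x r1) (height \<langle>l1, x, r1\<rangle>)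
      (\<lambda>h'. braun h' \<and> max_heap h' \<and> mset_tree h' = mset_tree \<langle>l1, x, r1\<rangle>)"
      using 3(1)[OF b] 3(3-5) by simp
    have "runs_within (timed_bind (sift_down l1 x r1) (\<lambda>l'. ret \<langle>l', y, \<langle>l2, z, r2\<rangle>\<rangle>))
        (height \<langle>l1, x, r1\<rangle> + 0)
     (\<lambda>h'. braun h' \<and> max_heap h' \<and> mset_tree h' = mset_tree \<langle>\<langle>l1, y, r1\<rangle>, x, \<langle>l2, z, r2\<rangle>\<rangle>)"
    proof (rule runs_within_bind[OF IH], elim conjE, rule runs_within_ret)
      fix l' assume l': "braun l'" "max_heap l'" "mset_tree l' = mset_tree \<langle>l1, x, r1\<rangle>"
      have "mset_tree l' = add_mset x (mset_tree l1 + mset_tree r1)" using l' by simp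
      note l'_eq = *[OF this]
      have "\<forall>w \<in> set_tree l'. fst w \<le> fst y" "\<forall>w \<in> set_tree l2 \<union> set_tree r2. fst w \<le> fst y"
        using l'_eq(2) 3(4,5) b by (auto intro: order_trans)
      then show "braun \<langle>l', y, \<langle>l2, z, r2\<rangle>\<rangle> \<and> max_heap \<langle>l', y, \<langle>l2, z, r2\<rangle>\<rangle> \<and>
          mset_tree \<langle>l', y, \<langle>l2, z, r2\<rangle>\<rangle> = mset_tree \<langle>\<langle>l1, y, r1\<rangle>, x, \<langle>l2, z, r2\<rangle>\<rangle>"
        using l' l'_eq(1) 3(3,5) b by auto
    qed
    then show ?thesis
      unfolding sift_down.simps if_not_P[OF b(1)] if_P[OF b(2)]
      by (rule runs_within_tick) simp
  next
    case c
    have IH: "runs_within (sift_down l2 x r2) (height \<langle>l2, x, r2\<rangle>)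
      (\<lambda>h'. braun h' \<and> max_heap h' \<and> mset_tree h' = mset_tree \<langle>l2, x, r2\<rangle>)"
      using 3(2)[OF c] 3(3-5) by simp
    have "runs_within (timed_bind (sift_down l2 x r2) (\<lambda>r'. ret \<langle>\<langle>l1, y, r1\<rangle>, z, r'\<rangle>))
        (height \<langle>l2, x, r2\<rangle> + 0)
     (\<lambda>h'. braun h' \<and> max_heap h' \<and> mset_tree h' = mset_tree \<langle>\<langle>l1, y, r1\<rangle>, x, \<langle>l2, z, r2\<rangle>\<rangle>)"
    proof (rule runs_within_bind[OF IH], elim conjE, rule runs_within_ret)
      fix r' assume r': "braun r'" "max_heap r'" "mset_tree r' = mset_tree \<langle>l2, x, r2\<rangle>"
      have "mset_tree r' = add_mset x (mset_tree l2 + mset_tree r2)" using r' by simp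
      note r'_eq = *[OF this]
      have "\<forall>w \<in> set_tree r'. fst w \<le> fst z" "\<forall>w \<in> set_tree l1 \<union> set_tree r1. fst w \<le> fst z"
        using r'_eq(2) 3(4,5) c by (auto intro: order_trans)
      then show "braun \<langle>\<langle>l1, y, r1\<rangle>, z, r'\<rangle> \<and> max_heap \<langle>\<langle>l1, y, r1\<rangle>, z, r'\<rangle> \<and>
          mset_tree \<langle>\<langle>l1, y, r1\<rangle>, z, r'\<rangle> = mset_tree \<langle>\<langle>l1, y, r1\<rangle>, x, \<langle>l2, z, r2\<rangle>\<rangle>"
        using r' r'_eq(1) 3(3,4) c by auto
    qed
    then show ?thesis
      unfolding sift_down.simps if_not_P[OF c(1)] if_not_P[OF c(2)]
      by (rule runs_within_tick) simp
  qed
qed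

text \<open>The shortened left subtree moves to the right, so the sizes become \<open>size r\<close>
  on the left and \<open>size l - 1\<close> on the right, which again differ by at most one in the
  allowed direction.\<close>

lemma remove_leftmost_correct:
  "braun h \<Longrightarrow> max_heap h \<Longrightarrow> h \<noteq> \<langle>\<rangle> \<Longrightarrow>
   runs_within (remove_leftmost h) (height h)
     (\<lambda>(z, h'). braun h' \<and> max_heap h' \<and> mset_tree h = add_mset z (mset_tree h'))"
proof (induction h rule: remove_leftmost.induct)
  case (2 x r)
  then show ?case by (auto intro!: runs_within_tick[where n = 0])
next
  case (3 ll y lr x r)
  define l where "l = \<langle>ll, y, lr\<rangle>"
  have IH: "runs_within (remove_leftmost l) (height l)
     (\<lambda>(z, h'). braun h' \<and> max_heap h' \<and> mset_tree l = add_mset z (mset_tree h'))"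
    using 3 unfolding l_def by simp
  have *: "size l = Suc (size h')" "set_tree l = insert z (set_tree h')"
    if "mset_tree l = add_mset z (mset_tree h')" for h' z
    using arg_cong[OF that, of size] arg_cong[OF that, of set_mset] by auto
  have "runs_within (timed_bind (remove_leftmost l) (\<lambda>(z, l'). ret (z, \<langle>r, x, l'\<rangle>))) (height l + 0)
     (\<lambda>(z, h'). braun h' \<and> max_heap h' \<and> mset_tree \<langle>l, x, r\<rangle> = add_mset z (mset_tree h'))"
  proof (rule runs_within_bind[OF IH], clarify, rule runs_within_ret)
    fix a b l' assume l': "braun l'" "max_heap l'" "mset_tree l = add_mset (a, b) (mset_tree l')"
    show "case ((a, b), \<langle>r, x, l'\<rangle>) of (z, h') \<Rightarrow> braun h' \<and> max_heap h' \<and>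
        mset_tree \<langle>l, x, r\<rangle> = add_mset z (mset_tree h')"
      using l' *[OF l'(3)] 3(2,3) unfolding l_def[symmetric] by auto
  qed
  then show ?case
    unfolding l_def[symmetric] remove_leftmost.simps(3)[of ll y lr x r, folded l_def]
    by (rule runs_within_tick) simp
qed simp

lemma extract_max_correct:
  assumes "braun h" "max_heap h" "h \<noteq> \<langle>\<rangle>"
  shows "runs_within (extract_max h) (1 + 2 * height h)
     (\<lambda>(x, h'). braun h' \<and> max_heap h' \<and> mset_tree h = add_mset x (mset_tree h') \<and>
        (\<forall>y \<in> set_tree h'. fst y \<le> fst x))"
  using assms
proof (induction h rule: extract_max.induct)
  case (2 x r)
  then show ?case by (auto intro!: runs_within_tick[where n = 0])
next
  case (3 ll y lr x r)
  define l where "l = \<langle>ll, y, lr\<rangle>"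
  note prems = 3[folded l_def]
  have *: "size l = Suc (size h')" "set_tree l = insert z (set_tree h')"
    if "mset_tree l = add_mset z (mset_tree h')" for h' z
    using arg_cong[OF that, of size] arg_cong[OF that, of set_mset] by auto
  have rl: "runs_within (remove_leftmost l) (height l)
     (\<lambda>(z, h'). braun h' \<and> max_heap h' \<and> mset_tree l = add_mset z (mset_tree h'))"
    using remove_leftmost_correct[of l] prems unfolding l_def by simp
  have "runs_within (timed_bind (remove_leftmost l)
      (\<lambda>(z, l'). timed_bind (sift_down r z l') (\<lambda>h. ret (x, h)))) (height l + Suc (height \<langle>l, x, r\<rangle>))
     (\<lambda>(x', h'). braun h' \<and> max_heap h' \<and> mset_tree \<langle>l, x, r\<rangle> = add_mset x' (mset_tree h') \<and>
        (\<forall>y \<in> set_tree h'. fst y \<le> fst x'))"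
  proof (rule runs_within_bind[OF rl], clarify)
    fix a b h' assume h': "braun h'" "max_heap h'" "mset_tree l = add_mset (a, b) (mset_tree h')"
    note ** = *[OF h'(3)]
    have br: "braun \<langle>r, (a, b), h'\<rangle>" using prems h' ** by auto
    \<comment> \<open>The multiset equation does not control the height of \<open>h'\<close>. It is
      bounded through its size and the Braun shape, at the loss of one level, which the factor 2 in
      the cost covers.\<close>
    have "(2::nat) ^ height h' \<le> 2 ^ Suc (height l)" 
    proof (cases "h' = \<langle>\<rangle>")
      case False
      then have "2 ^ height h' \<le> 2 * size h'" using braun_height h' by blast
      also have "\<dots> \<le> 2 * 2 ^ height l" using size1_height[of l] ** by (simp add: size1_size)
      finally show ?thesis by simp
    qed simp
    then have "height h' \<le> Suc (height l)" by (simp only: power_increasing_iff one_less_numeral_iff semiring_norm)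
    then have le: "height \<langle>r, (a, b), h'\<rangle> \<le> Suc (height \<langle>l, x, r\<rangle>)" by auto
    have sd: "runs_within (sift_down r (a, b) h') (Suc (height \<langle>l, x, r\<rangle>))
      (\<lambda>h''. braun h'' \<and> max_heap h'' \<and> mset_tree h'' = mset_tree \<langle>r, (a, b), h'\<rangle>)"
      using sift_down_correct[OF br] prems h' le by (auto intro: runs_within_mono)
    have set: "set_tree h'' = insert (a, b) (set_tree r \<union> set_tree h')"
      if "mset_tree h'' = add_mset (a, b) (mset_tree r + mset_tree h')" for h''
      using arg_cong[OF that, of set_mset] by auto
    have "runs_within (timed_bind (sift_down r (a, b) h') (\<lambda>h. ret (x, h))) (Suc (height \<langle>l, x, r\<rangle>) + 0)
      (\<lambda>(x', h'). braun h' \<and> max_heap h' \<and> mset_tree \<langle>l, x, r\<rangle> = add_mset x' (mset_tree h') \<and>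
        (\<forall>y \<in> set_tree h'. fst y \<le> fst x'))"
      using prems h' ** by (intro runs_within_bind[OF sd] runs_within_ret) (auto dest!: set)
    then show "runs_within (timed_bind (sift_down r (a, b) h') (\<lambda>h. ret (x, h))) (Suc (height \<langle>l, x, r\<rangle>))
      (\<lambda>(x', h'). braun h' \<and> max_heap h' \<and> mset_tree \<langle>l, x, r\<rangle> = add_mset x' (mset_tree h') \<and>
        (\<forall>y \<in> set_tree h'. fst y \<le> fst x'))" by simp
  qed
  then show ?case
    unfolding l_def[symmetric] extract_max.simps(3)[of ll y lr x r, folded l_def]
    by (rule runs_within_tick) simp
qed simp

text \<open>The multiset \<open>rest\<close> collects the entries discarded so far. The invariant is
  that they are no nearer than anything in the heap, and that nothing is discarded before the heap
  is full.\<close>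

lemma fill_heap_correct:
  assumes "1 \<le> k" "size h = n" "n \<le> k" "braun h" "max_heap h"
    and "\<forall>a \<in># rest. \<forall>b \<in> set_tree h. fst b \<le> fst a" and "rest = {#} \<or> n = k"
  shows "runs_within (fill_heap n k xs h) (Suc (length xs * (heap_height_bound k + 2)))
    (\<lambda>(n', h'). size h' = n' \<and> n' \<le> k \<and> braun h' \<and> max_heap h' \<and>
      (\<exists>rest'. mset_tree h' + rest' = mset_tree h + rest + mset xs \<and>
        (\<forall>a \<in># rest'. \<forall>b \<in> set_tree h'. fst b \<le> fst a) \<and> (rest' = {#} \<or> n' = k)))"
  using assms(2-)
proof (induction xs arbitrary: n h rest)
  case Nil
  then show ?case by (auto intro!: runs_within_tick[where n = 0])
next
  case (Cons x xs)
  let ?H = "heap_height_bound k"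
  let ?Q = "\<lambda>M (n', h'). size h' = n' \<and> n' \<le> k \<and> braun h' \<and> max_heap h' \<and>
      (\<exists>rest'. mset_tree h' + rest' = M + mset xs \<and>
        (\<forall>a \<in># rest'. \<forall>b \<in> set_tree h'. fst b \<le> fst a) \<and> (rest' = {#} \<or> n' = k))"
  let ?t = "Suc (length xs * (?H + 2))"
  have hh: "height h \<le> ?H" using height_le_heap_height_bound[of h k] Cons.prems by simp
  show ?case
  proof (cases "n < k")
    case True
    then have "rest = {#}" using Cons.prems by auto
    have ins: "runs_within (heap_insert x h) (Suc ?H)
       (\<lambda>h'. braun h' \<and> max_heap h' \<and> mset_tree h' = add_mset x (mset_tree h))"
      by (rule runs_within_mono[OF heap_insert_correct]) (use Cons.prems hh in auto)
    have "runs_within (timed_bind (heap_insert x h) (fill_heap (Suc n) k xs)) (Suc ?H + ?t)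
      (?Q (add_mset x (mset_tree h)))"
    proof (rule runs_within_bind[OF ins], elim conjE)
      fix h' assume h': "braun h'" "max_heap h'" "mset_tree h' = add_mset x (mset_tree h)"
      have "size h' = Suc n" using arg_cong[OF h'(3), of size] Cons.prems by simp
      then show "runs_within (fill_heap (Suc n) k xs h') ?t (?Q (add_mset x (mset_tree h)))"
        using Cons.IH[of h' "Suc n" "{#}"] h' True by simp
    qed
    then show ?thesis
      using True \<open>rest = {#}\<close> by simp (erule runs_within_tick, simp)
  next
    case False
    then have "n = k" using Cons.prems by simp
    then obtain l y r where h: "h = \<langle>l, y, r\<rangle>" using assms(1) Cons.prems(1) by (cases h) auto
    show ?thesis
    proof (cases "fst x < fst y")
      case True
      have sd: "runs_within (sift_down l x r) ?H
        (\<lambda>h'. braun h' \<and> max_heap h' \<and> mset_tree h' = mset_tree \<langle>l, x, r\<rangle>)"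
        by (rule runs_within_mono[OF sift_down_correct]) (use Cons.prems hh h in auto)
      \<comment> \<open>The old root \<open>y\<close> joins the discarded entries: it dominates
        everything now in the heap, and earlier discarded entries dominate \<open>y\<close>.\<close>
      have "runs_within (timed_bind (sift_down l x r) (fill_heap n k xs)) (?H + ?t)
        (?Q (mset_tree \<langle>l, x, r\<rangle> + add_mset y rest))"
      proof (rule runs_within_bind[OF sd], elim conjE)
        fix h' assume h': "braun h'" "max_heap h'" "mset_tree h' = mset_tree \<langle>l, x, r\<rangle>"
        have "size h' = n" using arg_cong[OF h'(3), of size] Cons.prems h by simp
        moreover have "set_tree h' = insert x (set_tree l \<union> set_tree r)"
          using arg_cong[OF h'(3), of set_mset] by simp
        moreover from this have "\<forall>b \<in> set_tree h'. fst b \<le> fst y"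
          using Cons.prems(4) True h by auto
        moreover have "\<forall>a \<in># rest. fst y \<le> fst a" using Cons.prems(5) h by simp
        ultimately have "\<forall>a \<in># add_mset y rest. \<forall>b \<in> set_tree h'. fst b \<le> fst a"
          by (auto intro: order_trans)
        then show "runs_within (fill_heap n k xs h') ?t (?Q (mset_tree \<langle>l, x, r\<rangle> + add_mset y rest))"
          using Cons.IH[of h' n "add_mset y rest"] h' \<open>n = k\<close> \<open>size h' = n\<close> by simp
      qed
      then show ?thesis
        unfolding fill_heap.simps h tree.case if_P[OF True] if_not_P[OF False]
        by (rule runs_within_mono[OF runs_within_tick]) (auto simp: add_mset_commute ac_simps)
    next
      case F: False
      have "runs_within (fill_heap n k xs h) ?t (?Q (mset_tree h + add_mset x rest))"
      proof -
        have "\<forall>b \<in> set_tree h. fst b \<le> fst y" using Cons.prems(4) h by auto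
        then have "\<forall>b \<in> set_tree h. fst b \<le> fst x" using F by fastforce
        then have "\<forall>a \<in># add_mset x rest. \<forall>b \<in> set_tree h. fst b \<le> fst a"
          using Cons.prems(5) by auto
        then show ?thesis
          using Cons.IH[of h n "add_mset x rest"] \<open>n = k\<close> Cons.prems by simp
      qed
      then show ?thesis
        unfolding fill_heap.simps h tree.case if_not_P[OF F] if_not_P[OF False]
        by (rule runs_within_mono[OF runs_within_tick]) (auto simp: add_mset_commute ac_simps)
    qed
  qed
qed

text \<open>Successive maxima are put in front of \<open>acc\<close>, which stays sorted because all
  its entries dominate the heap.\<close>

lemma drain_heap_correct:
  assumes "size h = n" "n \<le> k" "braun h" "max_heap h" "sorted (map fst acc)"
    and "\<forall>a \<in> set acc. \<forall>b \<in> set_tree h. fst b \<le> fst a"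
  shows "runs_within (drain_heap n h acc) (Suc (n * (2 * heap_height_bound k + 2)))
    (\<lambda>res. sorted (map fst res) \<and> mset res = mset_tree h + mset acc)"
  using assms
proof (induction n arbitrary: h acc)
  case 0
  then show ?case by (auto intro!: runs_within_tick[where n = 0])
next
  case (Suc n)
  let ?H = "heap_height_bound k"
  have hh: "height h \<le> ?H" using height_le_heap_height_bound[of h k] Suc.prems by simp
  have ex: "runs_within (extract_max h) (1 + 2 * ?H)
     (\<lambda>(x, h'). braun h' \<and> max_heap h' \<and> mset_tree h = add_mset x (mset_tree h') \<and>
        (\<forall>y \<in> set_tree h'. fst y \<le> fst x))"
    by (rule runs_within_mono[OF extract_max_correct]) (use Suc.prems hh in auto)
  have "runs_within (timed_bind (extract_max h) (\<lambda>(x, h'). drain_heap n h' (x # acc)))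
     (1 + 2 * ?H + Suc (n * (2 * ?H + 2)))
     (\<lambda>res. sorted (map fst res) \<and> mset res = mset_tree h + mset acc)"
  proof (rule runs_within_bind[OF ex], clarify)
    fix a b h' assume h': "braun h'" "max_heap h'" "mset_tree h = add_mset (a, b) (mset_tree h')"
      "\<forall>y \<in> set_tree h'. fst y \<le> fst (a, b)"
    have "size h' = n" using arg_cong[OF h'(3), of size] Suc.prems by simp
    moreover have "set_tree h = insert (a, b) (set_tree h')"
      using arg_cong[OF h'(3), of set_mset] by simp
    ultimately show "runs_within (drain_heap n h' ((a, b) # acc)) (Suc (n * (2 * ?H + 2)))
      (\<lambda>res. sorted (map fst res) \<and> mset res = mset_tree h + mset acc)"
      using Suc.IH[of h' "(a, b) # acc"] Suc.prems h' by (fastforce intro: runs_within_mono)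
  qed
  then show ?case by simp (erule runs_within_tick, simp)
qed

text \<open>The specification of \<open>select_nearest\<close>, with \<open>rest\<close> as the
  multiset of entries left out. Multisets are used because entries of equal distance may be chosen
  arbitrarily.\<close>

definition nearest_entries :: "nat \<Rightarrow> (real \<times> 'a) list \<Rightarrow> (real \<times> 'a) list \<Rightarrow> bool" where
  "nearest_entries k es sel \<longleftrightarrow> sorted (map fst sel) \<and>
     (\<exists>rest. mset sel + rest = mset es \<and> (\<forall>a \<in># rest. \<forall>b \<in> set sel. fst b \<le> fst a) \<and>
        (rest = {#} \<or> length sel = k)) \<and> length sel \<le> k"

lemma select_nearest_correct:
  assumes "1 \<le> k"
  shows "runs_within (select_nearest k es) (2 + length es * (3 * heap_height_bound k + 4))
    (nearest_entries k es)"
proof -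
  let ?H = "heap_height_bound k"
  have fill: "runs_within (fill_heap 0 k es \<langle>\<rangle>) (Suc (length es * (?H + 2)))
    (\<lambda>(n', h'). size h' = n' \<and> n' \<le> k \<and> braun h' \<and> max_heap h' \<and>
      (\<exists>rest'. mset_tree h' + rest' = mset es \<and>
        (\<forall>a \<in># rest'. \<forall>b \<in> set_tree h'. fst b \<le> fst a) \<and> (rest' = {#} \<or> n' = k)))"
    using fill_heap_correct[of k "\<langle>\<rangle>" 0 "{#}" es] assms by simp
  have "runs_within (select_nearest k es)
     (Suc (length es * (?H + 2)) + Suc (length es * (2 * ?H + 2))) (nearest_entries k es)"
    unfolding select_nearest_def
  proof (rule runs_within_bind[OF fill], clarify)
    fix a and h :: "'a heap" and rest
    assume h: "size h \<le> k" "braun h" "max_heap h" "mset_tree h + rest = mset es"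
      "\<forall>a \<in># rest. \<forall>b \<in> set_tree h. fst b \<le> fst a" "rest = {#} \<or> size h = k"
    have le: "size h \<le> length es"
      using arg_cong[OF h(4), of size] by simp
    have *: "set res = set_tree h" "length res = size h" if "mset res = mset_tree h" for res
      using arg_cong[OF that, of size] arg_cong[OF that, of set_mset] by auto
    show "runs_within (drain_heap (size h) h []) (Suc (length es * (2 * ?H + 2)))
       (nearest_entries k es)"
    proof (rule runs_within_mono[OF drain_heap_correct[where k = k]])
      show "Suc (size h * (2 * ?H + 2)) \<le> Suc (length es * (2 * ?H + 2))"
        using mult_le_mono1[OF le, of "2 * ?H + 2"] by simp
    next
      fix res assume res: "sorted (map fst res) \<and> mset res = mset_tree h + mset []"
      then show "nearest_entries k es res"
        unfolding nearest_entries_def using h *[of res] by auto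
    qed (use h in auto)
  qed
  then show ?thesis
    by (rule runs_within_mono) (auto simp: algebra_simps)
qed


section \<open>Compressed cover trees\<close>

locale cover_tree = Metric_space X d for X :: "'a set" and d :: "'a \<Rightarrow> 'a \<Rightarrow> real" +
  fixes R :: "'a set" and T :: "'a rooted_tree"
  assumes R_subset: "R \<subseteq> X" and tree: "compressed_cover_tree d R T"
begin

abbreviation "lv \<equiv> level_of T"
abbreviation "S \<equiv> distinctive_descendants T"

lemma finite_R: "finite R" and verts_eq: "verts T = R" and root_in: "root_of T \<in> R"
  using tree unfolding compressed_cover_tree_def by auto

lemma childD:
  assumes "a \<in> children T p"
  shows "a \<in> R" "p \<in> R" "lv a < lv p" "d p a \<le> 2 powi (lv a + 1)" "parent_of T a = p"
    "a \<noteq> root_of T"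
proof -
  show *: "a \<in> R" "parent_of T a = p" "a \<noteq> root_of T"
    using assms verts_eq unfolding children_def by auto
  then show "p \<in> R" "lv a < lv p" "d p a \<le> 2 powi (lv a + 1)"
    using tree unfolding compressed_cover_tree_def by (auto simp: commute[of p a])
qed

lemma cover_set_separated:
  "x \<in> cover_set T i \<Longrightarrow> y \<in> cover_set T i \<Longrightarrow> x \<noteq> y \<Longrightarrow> 2 powi i < d x y"
  using tree unfolding compressed_cover_tree_def by auto

lemma cover_set_iff: "x \<in> cover_set T i \<longleftrightarrow> x \<in> R \<and> i \<le> lv x"
  unfolding cover_set_def verts_eq by auto

lemma finite_children: "finite (children T p)"
  by (rule finite_subset[OF _ finite_R]) (use childD in auto)

lemma l_min_le: "x \<in> R \<Longrightarrow> l_min T \<le> lv x"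
  unfolding l_min_def verts_eq using finite_R by auto

section \<open>Descendants: order, levels and distances\<close>

lemma Desc_refl: "p \<in> Desc T p"
  by (simp add: Desc_def)

lemma Desc_trans: "v \<in> Desc T p \<Longrightarrow> u \<in> Desc T v \<Longrightarrow> u \<in> Desc T p"
  unfolding Desc_def by (auto intro: rtrancl_trans)

lemma child_in_Desc: "a \<in> children T p \<Longrightarrow> a \<in> Desc T p"
  unfolding Desc_def by auto

lemma Desc_unfold: "Desc T p = insert p (\<Union>a \<in> children T p. Desc T a)"
proof
  show "Desc T p \<subseteq> insert p (\<Union>a \<in> children T p. Desc T a)"
  proof
    fix u assume "u \<in> Desc T p"
    then have "(p, u) \<in> {(x, a). a \<in> children T x}\<^sup>*" by (simp add: Desc_def)
    then show "u \<in> insert p (\<Union>a \<in> children T p. Desc T a)"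
      by (cases rule: converse_rtranclE) (auto simp: Desc_def)
  qed
qed (auto intro: Desc_refl Desc_trans child_in_Desc)

lemma Desc_last:
  assumes "u \<in> Desc T p" "u \<noteq> p"
  shows "u \<in> R" "u \<noteq> root_of T" "parent_of T u \<in> Desc T p" "u \<in> children T (parent_of T u)"
proof -
  have "(p, u) \<in> {(x, a). a \<in> children T x}\<^sup>*" using assms by (simp add: Desc_def)
  then obtain y where y: "y \<in> Desc T p" "u \<in> children T y"
    using assms(2) by (cases rule: rtranclE) (auto simp: Desc_def)
  then show "u \<in> R" "u \<noteq> root_of T" "parent_of T u \<in> Desc T p" "u \<in> children T (parent_of T u)"
    using childD[OF y(2)] by auto
qed

lemma Desc_induct [consumes 1, case_names base step]:
  assumes "u \<in> Desc T p" "P p"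
    and "\<And>u v. u \<in> Desc T p \<Longrightarrow> P u \<Longrightarrow> v \<in> children T u \<Longrightarrow> P v"
  shows "P u"
proof -
  have "(p, u) \<in> {(x, a). a \<in> children T x}\<^sup>*" using assms by (simp add: Desc_def)
  then show ?thesis
    by (induction rule: rtrancl_induct) (use assms(2,3) in \<open>auto simp: Desc_def\<close>)
qed

lemma Desc_level:
  assumes "u \<in> Desc T p"
  shows "u = p \<or> lv u < lv p"
  using assms
proof (induction rule: Desc_induct)
  case (step u v)
  then show ?case using childD(3)[OF step.hyps(2)] by auto
qed simp

lemma Desc_subset:
  assumes "p \<in> R"
  shows "Desc T p \<subseteq> R"
proof
  fix u assume "u \<in> Desc T p"
  then show "u \<in> R" using assms Desc_last(1)[of u p] by (cases "u = p") auto
qed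

text \<open>The converse of the child relation is single-valued, so of two upward paths from
  \<open>u\<close> one continues the other.\<close>

lemma Desc_comparable:
  assumes "u \<in> Desc T p" "u \<in> Desc T p'"
  shows "p' \<in> Desc T p \<or> p \<in> Desc T p'"
proof -
  let ?r = "{(x, a). a \<in> children T x}"
  have "single_valued (?r\<inverse>)" by (auto simp: single_valued_def dest: childD)
  moreover have "(u, p) \<in> (?r\<inverse>)\<^sup>*" "(u, p') \<in> (?r\<inverse>)\<^sup>*"
    using assms by (auto simp: Desc_def rtrancl_converse)
  ultimately have "(p, p') \<in> (?r\<inverse>)\<^sup>* \<or> (p', p) \<in> (?r\<inverse>)\<^sup>*"
    by (rule single_valued_confluent)
  then show ?thesis by (auto simp: Desc_def rtrancl_converse)
qed

lemma Desc_siblings_disjoint: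
  assumes "a \<in> children T p" "b \<in> children T p" "a \<noteq> b"
  shows "Desc T a \<inter> Desc T b = {}"
proof (rule ccontr)
  assume "Desc T a \<inter> Desc T b \<noteq> {}"
  moreover have False if "a \<in> children T p" "b \<in> children T p" "a \<noteq> b" "b \<in> Desc T a" for a b
    using Desc_last(3)[of b a] Desc_level[of p a] childD[OF that(1)] childD[OF that(2)] that by auto
  ultimately show False using Desc_comparable assms by (metis disjoint_iff)
qed

text \<open>A geometric series. The extra summand \<open>2 powi (lv u + 1)\<close> is the room left
  below \<open>u\<close>: a step to a child \<open>v\<close> spends \<open>2 powi (lv v + 1)\<close>
  and leaves as much again, which fits since levels drop by at least one.\<close>

lemma Desc_dist:
  assumes "u \<in> Desc T p" "p \<in> R"
  shows "d p u + 2 powi (lv u + 1) \<le> 2 powi (lv p + 1)"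
  using assms
proof (induction rule: Desc_induct)
  case base
  then show ?case using R_subset by auto
next
  case (step u v)
  note v = childD[OF step.hyps(2)]
  have "d p v \<le> d p u + d u v" using step v R_subset by (intro triangle) auto
  moreover have "2 powi (lv v + 1) + 2 powi (lv v + 1) = (2::real) powi (lv v + 1 + 1)"
    by (simp add: power_int_add)
  moreover have "(2::real) powi (lv v + 1 + 1) \<le> 2 powi (lv u + 1)"
    using v by (intro power_int_increasing) auto
  ultimately show ?case using step v by linarith
qed

text \<open>Levels decrease along every path, so removing the subtrees of \<open>V T i p\<close>
  amounts to removing those of the children with level at least \<open>i\<close>.\<close>

lemma distinctive_descendants_eq:
  assumes "p \<in> R" "i \<le> lv p"
  shows "S i p = insert p (\<Union>a \<in> {a \<in> children T p. lv a < i}. Desc T a)"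
proof
  show "S i p \<subseteq> insert p (\<Union>a \<in> {a \<in> children T p. lv a < i}. Desc T a)"
  proof
    fix u assume u: "u \<in> S i p"
    then consider "u = p" | a where "a \<in> children T p" "u \<in> Desc T a"
      unfolding distinctive_descendants_def using Desc_unfold[of p] by auto
    then show "u \<in> insert p (\<Union>a \<in> {a \<in> children T p. lv a < i}. Desc T a)"
    proof cases
      case 2
      then have "a \<notin> V T i p" using u unfolding distinctive_descendants_def by auto
      then have "lv a < i"
        using childD[OF 2(1)] child_in_Desc[OF 2(1)] unfolding V_def by auto
      then show ?thesis using 2 by blast
    qed simp
  qed
next
  have "p \<in> S i p"
    using Desc_refl Desc_level unfolding distinctive_descendants_def V_def by fastforce
  moreover have "u \<in> S i p" if a: "a \<in> children T p" "lv a < i" "u \<in> Desc T a" for a u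
  proof -
    \<comment> \<open>Such a \<open>v\<close> is comparable with \<open>a\<close>. Below
      \<open>a\<close> its level is less than \<open>i\<close>; strictly above \<open>a\<close> it
      is also an ancestor of \<open>p\<close>, and its level is too high.\<close>
    have False if v: "v \<in> V T i p" "u \<in> Desc T v" for v
    proof -
      have lv: "i \<le> lv v" "lv v < lv p" using v unfolding V_def by auto
      have "v \<noteq> a" using lv a by auto
      consider "v \<in> Desc T a" | "a \<in> Desc T v" using Desc_comparable a v by blast
      then show False
      proof cases
        case 1
        then show False using Desc_level[OF 1] lv a by auto
      next
        case 2
        then have "p \<in> Desc T v" using Desc_last(3)[OF 2] \<open>v \<noteq> a\<close> childD[OF a(1)] by auto
        then show False using Desc_level lv by force
      qed
    qed
    then show ?thesis
      using a Desc_trans child_in_Desc unfolding distinctive_descendants_def by blast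
  qed
  ultimately show "insert p (\<Union>a \<in> {a \<in> children T p. lv a < i}. Desc T a) \<subseteq> S i p" by auto
qed

lemma distinctive_descendants_subset: "p \<in> R \<Longrightarrow> S i p \<subseteq> R"
  using Desc_subset unfolding distinctive_descendants_def by blast

text \<open>Points with a common descendant are nested, and the lower one, having level at least
  \<open>i\<close>, is among the nodes whose subtrees are removed for the upper one.\<close>

lemma distinctive_descendants_disjoint:
  assumes "p \<in> cover_set T i" "p' \<in> cover_set T i" "p \<noteq> p'"
  shows "S i p \<inter> S i p' = {}"
proof (rule ccontr)
  assume "S i p \<inter> S i p' \<noteq> {}"
  then obtain u where u: "u \<in> S i p" "u \<in> S i p'" by auto
  have False if "p \<in> cover_set T i" "p' \<in> cover_set T i" "p \<noteq> p'" "u \<in> S i p" "u \<in> Desc T p'"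
    "p' \<in> Desc T p" for p p'
  proof -
    have "p' \<in> V T i p" using that Desc_level[of p' p] unfolding V_def cover_set_def by auto
    then show False using that unfolding distinctive_descendants_def by auto
  qed
  moreover have Desc: "u \<in> Desc T p" "u \<in> Desc T p'"
    using u unfolding distinctive_descendants_def by auto
  ultimately show False
    using Desc_comparable[OF Desc] u assms by metis
qed

text \<open>The path from \<open>p\<close> to \<open>u\<close> starts with a child of level below
  \<open>i\<close>; the edge to this child and the way below it each cost at most
  \<open>2 powi i\<close>.\<close>

lemma distinctive_descendants_dist:
  assumes "p \<in> cover_set T i" "u \<in> S i p"
  shows "d p u \<le> 2 powi (i + 1)"
proof -
  have p: "p \<in> R" "i \<le> lv p" using assms cover_set_iff by auto
  consider "u = p" | a where "a \<in> children T p" "lv a < i" "u \<in> Desc T a"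
    using assms(2) distinctive_descendants_eq[OF p] by auto
  then show ?thesis
  proof cases
    case 1
    then show ?thesis using p R_subset by auto
  next
    case 2
    note a = childD[OF 2(1)]
    have "u \<in> R" using 2 a Desc_subset by blast
    then have "d p u \<le> d p a + d a u" using a p R_subset by (intro triangle) auto
    moreover have "d a u \<le> 2 powi (lv a + 1)"
      using Desc_dist[OF 2(3) a(1)] zero_less_power_int[of "2::real" "lv u + 1"] by linarith
    moreover have "2 powi (lv a + 1) + 2 powi (lv a + 1) = (2::real) powi (lv a + 1 + 1)"
      by (simp add: power_int_add)
    moreover have "(2::real) powi (lv a + 1 + 1) \<le> 2 powi (i + 1)"
      using 2 by (intro power_int_increasing) auto
    ultimately show ?thesis using a by linarith
  qed
qed

lemma Desc_root: "Desc T (root_of T) = R"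
proof
  show "R \<subseteq> Desc T (root_of T)"
  proof
    fix u assume "u \<in> R"
    then show "u \<in> Desc T (root_of T)"
    \<comment> \<open>Climbing to the parent raises the level, so the gap to the highest level
      shrinks.\<close>
    proof (induction "nat (Max (lv ` R) - lv u)" arbitrary: u rule: less_induct)
      case less
      show ?case
      proof (cases "u = root_of T")
        case False
        then have ch: "u \<in> children T (parent_of T u)"
          using less verts_eq unfolding children_def by auto
        note p = childD[OF ch]
        have "lv (parent_of T u) \<le> Max (lv ` R)" using p finite_R by auto
        then have "nat (Max (lv ` R) - lv (parent_of T u)) < nat (Max (lv ` R) - lv u)" using p by auto
        then have "parent_of T u \<in> Desc T (root_of T)" using less p by blast
        then show ?thesis using ch Desc_trans child_in_Desc by blast
      qed (simp add: Desc_refl)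
    qed
  qed
qed (use Desc_subset root_in in auto)

lemma distinctive_descendants_root:
  assumes "R \<noteq> {root_of T}"
  shows "S (l_max T) (root_of T) = R" "root_of T \<in> cover_set T (l_max T)"
proof -
  have le: "l_max T \<le> lv (root_of T)"
    using assms tree unfolding compressed_cover_tree_def by auto
  show "root_of T \<in> cover_set T (l_max T)" using le root_in cover_set_iff by auto
  have "lv a < l_max T" if "a \<in> children T (root_of T)" for a
  proof -
    have "lv a \<le> Max (lv ` (verts T - {root_of T}))"
      using childD[OF that] finite_R verts_eq by (intro Max_ge) auto
    then show ?thesis unfolding l_max_def by linarith
  qed
  then have "{a \<in> children T (root_of T). lv a < l_max T} = children T (root_of T)" by auto
  then show "S (l_max T) (root_of T) = R"
    using distinctive_descendants_eq[OF root_in le] Desc_unfold[of "root_of T"] Desc_root by auto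
qed

text \<open>Lowering the level by one separates the subtrees of the children with level exactly
  \<open>i\<close>. For such a child nothing is removed from its own subtree.\<close>

lemma distinctive_descendants_descend:
  assumes "p \<in> cover_set T (i + 1)"
  shows "S (i + 1) p = S i p \<union> (\<Union>a \<in> {a \<in> children T p. lv a = i}. S i a)"
proof -
  have p: "p \<in> R" "i + 1 \<le> lv p" "i \<le> lv p" using assms cover_set_iff by auto
  have "S i a = Desc T a" if "a \<in> children T p" "lv a = i" for a
  proof -
    have "{b \<in> children T a. lv b < i} = children T a" using childD that by auto
    then show ?thesis
      using distinctive_descendants_eq[of a i] childD[OF that(1)] that Desc_unfold[of a] by auto
  qed
  moreover have "{a \<in> children T p. lv a < i + 1} =
      {a \<in> children T p. lv a < i} \<union> {a \<in> children T p. lv a = i}" by auto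
  ultimately show ?thesis
    using distinctive_descendants_eq[OF p(1,2)] distinctive_descendants_eq[OF p(1,3)] by auto
qed

text \<open>The sentinel \<open>l_min T - 1\<close> need not lie below an arbitrary
  \<open>i\<close>, whence the second alternative in the first fact.\<close>

lemma Next_props:
  shows "Next T a i < i \<or> Next T a i < l_min T"
    and "l_min T - 1 \<le> Next T a i"
    and "b \<in> children T a \<Longrightarrow> lv b < i \<Longrightarrow> lv b \<le> Next T a i"
    and "l_min T \<le> Next T a i \<Longrightarrow> \<exists>b \<in> children T a. lv b = Next T a i"
proof -
  define L where "L = {j \<in> lv ` children T a. j < i}"
  have eq: "Next T a i = (if L = {} then l_min T - 1 else Max L)"
    unfolding Next_def L_def Let_def by simp
  have fin: "finite L" unfolding L_def using finite_children by simp
  have mem: "Next T a i \<in> L" if "L \<noteq> {}" using that eq fin by simp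
  have mem': "Next T a i < i" "\<exists>b \<in> children T a. lv b = Next T a i" if "L \<noteq> {}"
    using mem[OF that] unfolding L_def by auto
  have none: "Next T a i = l_min T - 1" if "L = {}" using eq that by simp
  show "Next T a i < i \<or> Next T a i < l_min T"
    using mem' none by (cases "L = {}") auto
  show "l_min T - 1 \<le> Next T a i"
  proof (cases "L = {}")
    case False
    then obtain b where "b \<in> children T a" "lv b = Next T a i" using mem' by blast
    then show ?thesis using l_min_le[of b] childD(1)[of b a] by simp
  qed (use none in simp)
  show "b \<in> children T a \<Longrightarrow> lv b < i \<Longrightarrow> lv b \<le> Next T a i"
  proof -
    assume "b \<in> children T a" "lv b < i"
    then have "lv b \<in> L" unfolding L_def by auto
    moreover from this have "L \<noteq> {}" by auto
    ultimately show ?thesis using eq fin by simp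
  qed
  show "l_min T \<le> Next T a i \<Longrightarrow> \<exists>b \<in> children T a. lv b = Next T a i"
    using mem' none by (cases "L = {}") auto
qed

text \<open>This justifies jumping over levels: without children at levels strictly between
  \<open>j\<close> and \<open>i\<close>, the same children count at \<open>j + 1\<close> and at
  \<open>i\<close>.\<close>

lemma distinctive_descendants_skip:
  assumes "p \<in> cover_set T i" "j < i" "\<And>a. a \<in> children T p \<Longrightarrow> lv a < i \<Longrightarrow> lv a \<le> j"
  shows "S (j + 1) p = S i p"
proof -
  have p: "p \<in> R" "i \<le> lv p" "j + 1 \<le> lv p" using assms cover_set_iff by auto
  have "{a \<in> children T p. lv a < i} = {a \<in> children T p. lv a < j + 1}" using assms by force
  then show ?thesis
    using distinctive_descendants_eq[OF p(1,2)] distinctive_descendants_eq[OF p(1,3)] by auto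
qed

text \<open>Once the loop has passed the lowest level, covering by distinctive descendants means
  plain membership.\<close>

lemma distinctive_descendants_below_l_min:
  assumes "p \<in> cover_set T i" "i \<le> l_min T"
  shows "S i p = {p}"
proof -
  have "{a \<in> children T p. lv a < i} = {}" using l_min_le childD assms(2) by fastforce
  then show ?thesis
    using distinctive_descendants_eq[of p i] assms cover_set_iff by (metis UN_empty)
qed

text \<open>These points are separated by \<open>2 powi i\<close> and lie within
  \<open>2 powi (i + 1)\<close> of \<open>p\<close>. The packing condition reads 8 + 1 \<le> 2^4,
  hence the exponent 4.\<close>

lemma card_children_level_le:
  assumes "p \<in> cover_set T i"
  shows "real (card (insert p {a \<in> children T p. lv a = i})) \<le> minimized_expansion_constant R ^ 4"
proof -
  have "p \<in> R" "p \<in> X" using assms R_subset cover_set_iff by auto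
  show ?thesis
  proof (rule card_separated_le[OF finite_R R_subset, where q = p and t = "2 powi (i + 1)" and \<delta> = "2 powi i"])
    show "insert p {a \<in> children T p. lv a = i} \<subseteq> mcball p (2 powi (i + 1))"
      using childD \<open>p \<in> X\<close> R_subset by (auto simp: mcball_def)
    show "x \<in> insert p {a \<in> children T p. lv a = i} \<Longrightarrow> y \<in> insert p {a \<in> children T p. lv a = i} \<Longrightarrow>
       x \<noteq> y \<Longrightarrow> 2 powi i < d x y" for x y
      by (rule cover_set_separated) (use assms childD cover_set_iff in auto)
    show "(4::real) * 2 powi (i + 1) + 2 powi i \<le> 2 ^ 4 * 2 powi i" by (simp add: power_int_add)
  qed (use \<open>p \<in> R\<close> childD in auto)
qed

text \<open>The packing condition reads 32 + 1 \<le> 2^6, hence the exponent 6.\<close>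

lemma card_cover_set_ball_le:
  assumes "A \<subseteq> cover_set T i" "q \<in> X" "\<And>p. p \<in> A \<Longrightarrow> d q p \<le> 2 powi (i + 3)"
  shows "real (card A) \<le> minimized_expansion_constant R ^ 6"
proof (rule card_separated_le[OF finite_R R_subset, where q = q and t = "2 powi (i + 3)" and \<delta> = "2 powi i"])
  have "A \<subseteq> R" using assms cover_set_iff by auto
  then show "A \<subseteq> mcball q (2 powi (i + 3))" "A \<subseteq> R"
    using assms R_subset by (auto simp: mcball_def)
  show "x \<in> A \<Longrightarrow> y \<in> A \<Longrightarrow> x \<noteq> y \<Longrightarrow> 2 powi i < d x y" for x y
    using cover_set_separated assms by blast
  show "(4::real) * 2 powi (i + 3) + 2 powi i \<le> 2 ^ 6 * 2 powi i" by (simp add: power_int_add)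
qed (use root_in in auto)

end


section \<open>Nearest neighbors\<close>

lemma card_within_eq_sorted_distances:
  assumes "finite R"
  shows "card {u \<in> R. d q u \<le> r} = length (filter (\<lambda>x. x \<le> r) (sorted_distances d q R))"
proof -
  have "length (filter (\<lambda>x. x \<le> r) (sorted_distances d q R)) =
      size (filter_mset (\<lambda>x. x \<le> r) (mset (sorted_distances d q R)))"
    by (metis mset_filter size_mset)
  also have "\<dots> = size (mset_set {u \<in> R. d q u \<le> r})"
    using assms by (simp add: sorted_distances_def filter_mset_image_mset)
  finally show ?thesis by simp
qed

lemma length_sorted_distances: "finite R \<Longrightarrow> length (sorted_distances d q R) = card R"
  unfolding sorted_distances_def
  by (metis mset_sorted_list_of_multiset size_image_mset size_mset size_mset_set)

lemma sorted_sorted_distances: "sorted (sorted_distances d q R)"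
  unfolding sorted_distances_def by simp

text \<open>Together with \<open>nn_dist_le\<close> this identifies \<open>nn_dist d k q R\<close>
  as the least radius around \<open>q\<close> that captures \<open>k\<close> points of
  \<open>R\<close>.\<close>

lemma card_within_nn_dist:
  assumes "finite R" "1 \<le> k" "k \<le> card R"
  shows "k \<le> card {u \<in> R. d q u \<le> nn_dist d k q R}"
proof -
  let ?ds = "sorted_distances d q R" and ?P = "\<lambda>x. x \<le> nn_dist d k q R"
  have len: "k \<le> length ?ds" using assms length_sorted_distances by metis
  have "?P x" if x: "x \<in> set (take k ?ds)" for x
  proof -
    obtain m where "m < k" "x = ?ds ! m" using x len by (auto simp: in_set_conv_nth)
    then show ?thesis
      unfolding nn_dist_def using sorted_nth_mono[OF sorted_sorted_distances, of m "k - 1" d q R] len by auto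
  qed
  then have "filter ?P (take k ?ds) = take k ?ds" by (simp add: filter_id_conv)
  then have "k \<le> length (filter ?P (take k ?ds @ drop k ?ds))"
    using len by (simp del: append_take_drop_id)
  then show ?thesis using card_within_eq_sorted_distances assms by (metis append_take_drop_id)
qed

lemma nn_dist_le:
  assumes "finite R" "1 \<le> k" "k \<le> card {u \<in> R. d q u \<le> r}"
  shows "nn_dist d k q R \<le> r"
proof (rule ccontr)
  assume not: "\<not> nn_dist d k q R \<le> r"
  let ?ds = "sorted_distances d q R" and ?P = "\<lambda>x. x \<le> r"
  have "\<not> ?P x" if x: "x \<in> set (drop (k - 1) ?ds)" for x
  proof -
    obtain m where "k - 1 + m < length ?ds" "x = ?ds ! (k - 1 + m)"
      using x by (auto simp: in_set_conv_nth less_diff_conv add.commute)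
    then show ?thesis
      using sorted_nth_mono[OF sorted_sorted_distances, of "k - 1" "k - 1 + m" d q R] not
      unfolding nn_dist_def by auto
  qed
  then have "filter ?P (drop (k - 1) ?ds) = []" by (simp add: filter_empty_conv)
  then have "length (filter ?P (take (k - 1) ?ds @ drop (k - 1) ?ds)) \<le> length (take (k - 1) ?ds)"
    unfolding filter_append length_append by (simp only: list.size add_0_right length_filter_le)
  also have "\<dots> \<le> k - 1" by simp
  finally show False
    using card_within_eq_sorted_distances[OF assms(1), of d q r] assms by simp
qed

lemma nearest_entriesD:
  assumes "distinct ps" and near: "nearest_entries k (map (\<lambda>p. (d q p, p)) ps) sel"
  shows "sorted (map fst sel)" "distinct (map snd sel)"
    "\<forall>e\<in>set sel. snd e \<in> set ps \<and> fst e = d q (snd e)"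
    "\<forall>p\<in>set ps - snd ` set sel. \<forall>e\<in>set sel. fst e \<le> d q p"
    "length sel = min k (length ps)"
proof -
  let ?es = "map (\<lambda>p. (d q p, p)) ps"
  obtain rest where rest: "mset sel + rest = mset ?es" "\<forall>a \<in># rest. \<forall>b \<in> set sel. fst b \<le> fst a"
      "rest = {#} \<or> length sel = k" and sel: "sorted (map fst sel)" "length sel \<le> k"
    using near unfolding nearest_entries_def by auto
  obtain rl where rl: "mset rl = rest" using ex_mset by blast
  then have eq: "mset (sel @ rl) = mset ?es" using rest by simp
  have "length (sel @ rl) = length ?es" using eq by (rule mset_eq_length)
  then show "length sel = min k (length ps)" using rest(3) sel rl by auto
  have "mset (map snd (sel @ rl)) = mset (map snd ?es)"
    using arg_cong[OF eq, of "image_mset snd"] unfolding mset_map .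
  also have "map snd ?es = ps" by (simp add: comp_def)
  finally have "mset (map snd (sel @ rl)) = mset ps" .
  then have "distinct (map snd (sel @ rl))" using assms(1) mset_eq_imp_distinct_iff by blast
  then show "distinct (map snd sel)" by simp
  have set: "set sel \<union> set rl = set ?es" using mset_eq_setD[OF eq] by simp
  then have "set sel \<subseteq> set ?es" by blast
  then show "\<forall>e\<in>set sel. snd e \<in> set ps \<and> fst e = d q (snd e)" by auto
  show "\<forall>p\<in>set ps - snd ` set sel. \<forall>e\<in>set sel. fst e \<le> d q p"
  proof (intro ballI)
    fix p e assume p: "p \<in> set ps - snd ` set sel" and e: "e \<in> set sel"
    have "(d q p, p) \<in> set sel \<union> set rl" using p set by auto
    then have "(d q p, p) \<in> set rl" using p by force
    then show "fst e \<le> d q p" using rest(2) e rl by force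
  qed
qed (use near nearest_entries_def in auto)

text \<open>Candidates may be restricted to any subset of \<open>R\<close> containing
  \<open>NN d k q R\<close>: the distances of the selected points then form the beginning of
  \<open>sorted_distances d q R\<close>.\<close>

lemma all_k_nearest_neighbors_of_superset:
  assumes fin: "finite R" and k: "1 \<le> k" "k \<le> card R"
    and ps: "distinct ps" "set ps \<subseteq> R" "NN d k q R \<subseteq> set ps"
    and near: "nearest_entries k (map (\<lambda>p. (d q p, p)) ps) sel"
  shows "all_k_nearest_neighbors d k q R (map snd sel)"
proof -
  let ?us = "map snd sel" and ?\<rho> = "nn_dist d k q R"
  note sel = nearest_entriesD[where d = d and q = q, OF ps(1) near]
  have cNN: "k \<le> card (NN d k q R)" using card_within_nn_dist[OF fin k] unfolding NN_def .
  also have "\<dots> \<le> card (set ps)" using ps by (intro card_mono) auto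
  finally have len: "length sel = k" using sel(5) distinct_card[OF ps(1)] by simp
  have map_eq: "map fst sel = map (d q) ?us" using sel(3) by auto
  have us: "set ?us \<subseteq> set ps" using sel(3) by auto
  have gap: "d q b \<le> d q v" if "v \<in> set ps - set ?us" "b \<in> set ?us" for v b
    using sel(3,4) that by fastforce
  \<comment> \<open>If a selected \<open>b\<close> were farther than the \<open>k\<close>-th
    distance, all points of \<open>NN d k q R\<close>, at least \<open>k\<close> of them, would have
    been selected besides \<open>b\<close>.\<close>
  have le: "d q b \<le> ?\<rho>" if b: "b \<in> set ?us" for b
  proof (rule ccontr)
    assume not: "\<not> d q b \<le> ?\<rho>"
    have "NN d k q R \<subseteq> set ?us - {b}"
    proof
      fix v assume v: "v \<in> NN d k q R"
      then have "d q v < d q b" using not unfolding NN_def by auto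
      then show "v \<in> set ?us - {b}" using gap[of v b] b v ps by force
    qed
    then have "card (NN d k q R) \<le> card (set ?us - {b})" by (intro card_mono) auto
    also have "\<dots> < card (set ?us)" using b by (intro psubset_card_mono) auto
    also have "\<dots> = k" using distinct_card[OF sel(2)] len by simp
    finally show False using cNN by simp
  qed
  have out: "d q b \<le> d q v" if "v \<in> R - set ?us" "b \<in> set ?us" for v b
  proof (cases "v \<in> set ps")
    case False
    then have "?\<rho> < d q v" using that ps unfolding NN_def by auto
    then show ?thesis using le[OF that(2)] by simp
  qed (use gap that in auto)
  \<comment> \<open>The sorted distances of the points not selected. Appending them gives a sorted
    list with the right multiset, which is unique.\<close>
  define ys where "ys = sorted_list_of_multiset (image_mset (d q) (mset_set (R - set ?us)))"
  have ys: "sorted ys" "mset ys = image_mset (d q) (mset_set (R - set ?us))"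
    unfolding ys_def by simp_all
  have "set ys = d q ` (R - set ?us)"
    using arg_cong[OF ys(2), of set_mset] fin by simp
  then have "sorted (map (d q) ?us @ ys)"
    using sel(1) ys(1) out map_eq unfolding sorted_append by auto
  moreover have "mset (map (d q) ?us @ ys) = image_mset (d q) (mset_set R)"
  proof -
    have "R = set ?us \<union> (R - set ?us)" using us ps by auto
    then have "mset_set R = mset_set (set ?us) + mset_set (R - set ?us)"
      using mset_set_Union[of "set ?us" "R - set ?us"] fin by simp
    then have "image_mset (d q) (mset_set R) = image_mset (d q) (mset ?us) + mset ys"
      using mset_set_set[OF sel(2)] ys(2) by (simp only: image_mset_union)
    then show ?thesis by (simp only: mset_append mset_map)
  qed
  ultimately have sd: "sorted_distances d q R = map (d q) ?us @ ys"
    unfolding sorted_distances_def by (metis sorted_list_of_multiset_mset sorted_sort_id)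
  show ?thesis
    unfolding all_k_nearest_neighbors_def
  proof (intro conjI ballI)
    show "length ?us = k" "distinct ?us" using len sel(2) by auto
    show "set ?us \<subseteq> NN d k q R" using us ps(2) le unfolding NN_def by blast
    show "d q (?us ! (j - 1)) = nn_dist d j q R" if "j \<in> {1..k}" for j
    proof -
      have "j - 1 < length (map (d q) ?us)" using that len by auto
      then show ?thesis unfolding nn_dist_def sd by (simp only: nth_append if_True nth_map length_map)
    qed
  qed
qed


section \<open>The subroutines of the search\<close>

lemma with_distances_correct:
  "runs_within (with_distances d q ps) (length ps) (\<lambda>es. es = map (\<lambda>p. (d q p, p)) ps)"
  unfolding with_distances_def by (rule runs_within_tick[where n = 0]) auto

lemma entries_within_correct:
  "runs_within (entries_within b es) (length es) (\<lambda>ps. ps = map snd (filter (\<lambda>e. fst e \<le> b) es))"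
  unfolding entries_within_def by (rule runs_within_tick[where n = 0]) auto

lemma max_Next_correct:
  "runs_within (max_Next T i ps) (length ps) (\<lambda>j. j = Max ((\<lambda>a. Next T a i) ` set ps))"
  unfolding max_Next_def by (rule runs_within_tick[where n = 0]) auto

lemma add_children_correct:
  "runs_within (add_children grp i ps) (1 + length (concat (map (\<lambda>p. p # grp p i) ps)))
     (\<lambda>C. C = concat (map (\<lambda>p. p # grp p i) ps))"
proof (induction ps)
  case Nil
  then show ?case by (auto intro!: runs_within_tick[where n = 0])
next
  case (Cons p ps)
  have "runs_within (timed_bind (add_children grp i ps) (\<lambda>cs. ret (p # grp p i @ cs)))
     (1 + length (concat (map (\<lambda>p. p # grp p i) ps)) + 0)
     (\<lambda>C. C = concat (map (\<lambda>p. p # grp p i) (p # ps)))"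
    by (rule runs_within_bind[OF Cons.IH]) auto
  then show ?case by simp (erule runs_within_tick, simp)
qed

text \<open>The threshold is met at the last entry at the latest. Nonemptiness matters because the
  scan of \<open>[]\<close> fails even if \<open>k \<le> s\<close>.\<close>

lemma scan_sizes_succeeds:
  assumes "es \<noteq> []" "k \<le> s + (\<Sum>e\<leftarrow>es. card (distinctive_descendants T i (snd e)))"
  shows "runs_within (scan_sizes T i k s es) (length es) (\<lambda>_. True)"
  using assms
proof (induction es arbitrary: s)
  case (Cons e es)
  let ?s = "s + card (distinctive_descendants T i (snd e))"
  have "runs_within (if k \<le> ?s then ret e else scan_sizes T i k ?s es) (length es) (\<lambda>_. True)"
  proof (cases "k \<le> ?s")
    case False
    then have "es \<noteq> []" using Cons.prems by auto
    then show ?thesis using Cons.IH[of ?s] Cons.prems False by (simp add: add.assoc)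
  qed auto
  then show ?case unfolding scan_sizes.simps Let_def by (rule runs_within_tick) simp
qed simp

lemma output_nearest_correct:
  assumes "finite R" "1 \<le> k" "k \<le> card R" "distinct ps" "set ps \<subseteq> R" "NN d k q R \<subseteq> set ps"
  shows "runs_within (output_nearest d q k ps) (2 + length ps * (3 * heap_height_bound k + 6))
    (all_k_nearest_neighbors d k q R)"
proof -
  let ?es = "map (\<lambda>p. (d q p, p)) ps"
  have "runs_within (timed_bind (select_nearest k ?es)
      (\<lambda>sel. timed_bind (tick (length sel)) (\<lambda>_. ret (map snd sel))))
      (2 + length ?es * (3 * heap_height_bound k + 4) + length ps) (all_k_nearest_neighbors d k q R)"
  proof (rule runs_within_bind[OF select_nearest_correct[OF assms(2)]])
    fix sel assume sel: "nearest_entries k ?es sel"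
    have "length sel \<le> length ps" using nearest_entriesD(5)[where d = d and q = q, OF assms(4) sel] by simp
    then show "runs_within (timed_bind (tick (length sel)) (\<lambda>_. ret (map snd sel))) (length ps)
        (all_k_nearest_neighbors d k q R)"
      using all_k_nearest_neighbors_of_superset[OF assms sel]
      by (intro runs_within_tick[where n = 0] runs_within_ret) auto
  qed
  then have "runs_within (output_nearest d q k ps)
     (length ps + (2 + length ?es * (3 * heap_height_bound k + 4) + length ps))
     (all_k_nearest_neighbors d k q R)"
    unfolding output_nearest_def by (intro runs_within_bind[OF with_distances_correct]) simp
  then show ?thesis by (rule runs_within_mono) (auto simp: algebra_simps)
qed

lemma mset_set_UN_disjoint:
  assumes "finite I" "\<And>i. i \<in> I \<Longrightarrow> finite (A i)"
    "\<And>i j. i \<in> I \<Longrightarrow> j \<in> I \<Longrightarrow> i \<noteq> j \<Longrightarrow> A i \<inter> A j = {}"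
  shows "mset_set (\<Union>i\<in>I. A i) = (\<Sum>i\<in>I. mset_set (A i))"
  using assms
proof (induction I rule: finite_induct)
  case (insert i I)
  have "A i \<inter> (\<Union>j\<in>I. A j) = {}" using insert.prems(2)[of i] insert.hyps by auto
  then have "mset_set (A i \<union> (\<Union>j\<in>I. A j)) = mset_set (A i) + mset_set (\<Union>j\<in>I. A j)"
    using insert.prems(1) insert.hyps by (intro mset_set_Union) auto
  then show ?case using insert by simp
qed simp

lemma sum_list_add_mset:
  "(\<Sum>a\<leftarrow>xs. add_mset a (f a)) = mset xs + (\<Sum>a\<leftarrow>xs. f a)"
  by (induction xs) auto

context cover_tree
begin

text \<open>What a stack entry \<open>(p, i)\<close> still has to contribute to the traversal. A
  multiset makes the contributions of a whole stack additive and their total size a cost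
  measure.\<close>

definition below :: "'a \<Rightarrow> int \<Rightarrow> 'a multiset" where
  "below p i = (\<Sum>a \<in> {a \<in> children T p. lv a < i}. mset_set (Desc T a))"

lemma finite_Desc: "p \<in> R \<Longrightarrow> finite (Desc T p)"
  using Desc_subset finite_R finite_subset by metis

lemma mset_set_distinctive_descendants:
  assumes "p \<in> R" "i \<le> lv p"
  shows "mset_set (S i p) = add_mset p (below p i)"
proof -
  let ?I = "{a \<in> children T p. lv a < i}"
  have "p \<notin> Desc T a" if "a \<in> children T p" for a
    using Desc_level[of p a] childD[OF that] by auto
  then have "p \<notin> (\<Union>a\<in>?I. Desc T a)" by auto
  moreover have "finite (Desc T a)" if "a \<in> ?I" for a using childD that finite_Desc by auto
  moreover have "finite ?I" using finite_children by simp
  moreover have "mset_set (\<Union>a\<in>?I. Desc T a) = below p i"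
    unfolding below_def using calculation
    by (intro mset_set_UN_disjoint Desc_siblings_disjoint) auto
  ultimately show ?thesis using distinctive_descendants_eq[OF assms] by simp
qed

lemma mset_set_Desc:
  assumes "a \<in> R"
  shows "mset_set (Desc T a) = add_mset a (below a (lv a))"
proof -
  have "{b \<in> children T a. lv b < lv a} = children T a" using childD by auto
  then have "S (lv a) a = Desc T a"
    using distinctive_descendants_eq[OF assms order_refl] Desc_unfold[of a] by simp
  then show ?thesis using mset_set_distinctive_descendants[OF assms, of "lv a"] by simp
qed

end

locale knn_problem = cover_tree X d R T
  for X :: "'a set" and d R and T :: "'a rooted_tree" +
  fixes q :: 'a and k :: nat and grp :: "'a \<Rightarrow> int \<Rightarrow> 'a list"
  assumes q_in: "q \<in> X" and k: "1 \<le> k" "k \<le> card R" and stored: "stores_children T grp"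
begin

section \<open>Tree traversal\<close>

lemma grp: "p \<in> R \<Longrightarrow> distinct (grp p i)" "p \<in> R \<Longrightarrow> set (grp p i) = {a \<in> children T p. lv a = i}"
  using stored verts_eq unfolding stores_children_def by auto

text \<open>Peels off the highest pending level \<open>j\<close>. The children \<open>a\<close> in
  this group have level \<open>j\<close>, so \<open>below a j\<close> comprises all their proper
  descendants.\<close>

lemma below_Next_eq:
  assumes p: "p \<in> R" and j: "l_min T \<le> Next T p i"
  defines "j \<equiv> Next T p i"
  shows "below p i = (\<Sum>a\<leftarrow>grp p j. add_mset a (below a j)) + below p j" "grp p j \<noteq> []"
proof -
  note N = Next_props[where a = p and i = i, folded j_def]
  have "j < i"
    using N(1) j unfolding j_def by auto
  then have split: "{a \<in> children T p. lv a < i} = set (grp p j) \<union> {a \<in> children T p. lv a < j}"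
    using N(3) grp(2)[OF p] by force
  have "below p i = (\<Sum>a\<in>set (grp p j). mset_set (Desc T a)) + below p j"
    unfolding below_def split using grp(2)[OF p] finite_children by (intro sum.union_disjoint) auto
  also have "(\<Sum>a\<in>set (grp p j). mset_set (Desc T a)) = (\<Sum>a\<leftarrow>grp p j. mset_set (Desc T a))"
    using grp(1)[OF p] by (simp add: sum_list_distinct_conv_sum_set)
  also have "\<dots> = (\<Sum>a\<leftarrow>grp p j. add_mset a (below a j))"
    using grp(2)[OF p] childD(1) mset_set_Desc by (intro arg_cong[of _ _ sum_list] map_cong) auto
  finally show "below p i = (\<Sum>a\<leftarrow>grp p j. add_mset a (below a j)) + below p j" .
  show "grp p j \<noteq> []" using N(4) j grp(2)[OF p, of j] unfolding j_def by auto
qed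

lemma below_eq_empty:
  assumes "Next T p i < l_min T"
  shows "below p i = {#}"
proof -
  have "{a \<in> children T p. lv a < i} = {}"
  proof (rule ccontr)
    assume "\<not> ?thesis"
    then obtain a where a: "a \<in> children T p" "lv a < i" by auto
    then show False using Next_props(3)[OF a] l_min_le[OF childD(1)[OF a(1)]] assms by simp
  qed
  then show ?thesis unfolding below_def by (simp only: sum.empty)
qed

text \<open>Expanding an entry with \<open>g > 0\<close> children lengthens the stack by
  \<open>g\<close> and removes \<open>g\<close> nodes from the pending total, so weight 2 per
  pending node makes the measure drop. The step costs \<open>1 + g\<close> and the longer stack
  \<open>g\<close> more, in all at most \<open>3 * g\<close>.\<close>

lemma traverse_correct:
  assumes "fst ` set stack \<subseteq> R"
  shows "runs_within (traverse T grp stack acc)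
    (1 + length stack + 3 * size (\<Sum>e\<leftarrow>stack. below (fst e) (snd e)))
    (\<lambda>res. mset res = mset acc + (\<Sum>e\<leftarrow>stack. below (fst e) (snd e)))"
  using assms
proof (induction "length stack + 2 * size (\<Sum>e\<leftarrow>stack. below (fst e) (snd e))"
    arbitrary: stack acc rule: less_induct)
  case less
  show ?case
  proof (cases stack)
    case Nil
    then show ?thesis
      by (subst traverse.simps) (auto intro!: runs_within_tick[where n = 0])
  next
    case (Cons e st)
    define p j where "p = fst e" and "j = Next T p (snd e)"
    have p: "p \<in> R" using less.prems Cons unfolding p_def by auto
    let ?B = "\<Sum>e\<leftarrow>st. below (fst e) (snd e)"
    have unf: "traverse T grp stack acc = timed_bind (tick 1) (\<lambda>_. if j < l_min T
       then traverse T grp st acc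
       else timed_bind (tick (length (grp p j)))
         (\<lambda>_. traverse T grp (map (\<lambda>a. (a, j)) (grp p j) @ (p, j) # st) (grp p j @ acc)))"
      by (subst traverse.simps) (simp add: Cons p_def j_def Let_def)
    show ?thesis
    proof (cases "j < l_min T")
      case True
      then have "below (fst e) (snd e) = {#}" using below_eq_empty unfolding j_def p_def by blast
      then show ?thesis
        unfolding unf if_P[OF True]
        using less.hyps[of st acc] less.prems Cons by (intro runs_within_tick) auto
    next
      case False
      let ?g = "length (grp p j)"
      let ?stack = "map (\<lambda>a. (a, j)) (grp p j) @ (p, j) # st"
      let ?B' = "\<Sum>e\<leftarrow>?stack. below (fst e) (snd e)"
      have bel: "below p (snd e) = (\<Sum>a\<leftarrow>grp p j. add_mset a (below a j)) + below p j" "?g > 0"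
        using below_Next_eq[of p "snd e"] p False unfolding j_def by auto
      have B: "(\<Sum>e\<leftarrow>stack. below (fst e) (snd e)) = mset (grp p j) + ?B'"
        using bel(1) Cons unfolding p_def[symmetric] by (simp add: sum_list_add_mset comp_def p_def)
      then have sizeB: "size (\<Sum>e\<leftarrow>stack. below (fst e) (snd e)) = ?g + size ?B'" by simp
      have "runs_within (traverse T grp ?stack (grp p j @ acc)) (1 + length ?stack + 3 * size ?B')
        (\<lambda>res. mset res = mset (grp p j @ acc) + ?B')"
      proof (rule less.hyps)
        show "length ?stack + 2 * size ?B' <
            length stack + 2 * size (\<Sum>e\<leftarrow>stack. below (fst e) (snd e))"
          unfolding sizeB using bel(2) Cons by simp
        show "fst ` set ?stack \<subseteq> R" using less.prems p Cons grp(2)[OF p] childD(1) by auto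
      qed
      then have tr: "runs_within (traverse T grp ?stack (grp p j @ acc)) (1 + length ?stack + 3 * size ?B')
        (\<lambda>res. mset res = mset acc + (\<Sum>e\<leftarrow>stack. below (fst e) (snd e)))"
        by (rule runs_within_mono) (simp_all only: B mset_append ac_simps order_refl)
      show ?thesis
        unfolding unf if_not_P[OF False]
        by (rule runs_within_tick[OF runs_within_tick[OF tr order_refl]])
          (use sizeB Suc_leI[OF bel(2)] Cons in simp)
    qed
  qed
qed

lemma collect_descendants_correct:
  assumes ps: "distinct ps" "set ps \<subseteq> cover_set T i"
  defines "U \<equiv> (\<Union>p\<in>set ps. S i p)"
  shows "runs_within (collect_descendants T grp i ps) (1 + 3 * card U)
    (\<lambda>res. distinct res \<and> set res = U)"
proof -
  let ?B = "\<Sum>p\<leftarrow>ps. below p i"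
  have R: "set ps \<subseteq> R" using ps cover_set_iff by auto
  have finS: "finite (S i p)" if "p \<in> R" for p
    using distinctive_descendants_subset[OF that] finite_R finite_subset by metis
  then have fin: "finite U" unfolding U_def using R by auto
  have "mset_set U = (\<Sum>p\<in>set ps. mset_set (S i p))"
    unfolding U_def using distinctive_descendants_disjoint ps R finS
    by (intro mset_set_UN_disjoint) auto
  also have "\<dots> = (\<Sum>p\<leftarrow>ps. mset_set (S i p))"
    using ps(1) by (simp add: sum_list_distinct_conv_sum_set)
  also have "\<dots> = (\<Sum>p\<leftarrow>ps. add_mset p (below p i))"
    using ps(2) cover_set_iff mset_set_distinctive_descendants
    by (intro arg_cong[of _ _ sum_list] map_cong) auto
  finally have U: "mset_set U = mset ps + ?B" by (simp add: sum_list_add_mset)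
  then have card: "card U = length ps + size ?B" by (metis size_mset size_mset_set size_union)
  have "runs_within (traverse T grp (map (\<lambda>p. (p, i)) ps) ps) (1 + length ps + 3 * size ?B)
      (\<lambda>res. mset res = mset ps + ?B)"
    using traverse_correct[of "map (\<lambda>p. (p, i)) ps" ps] R by (simp add: comp_def image_comp)
  then have "runs_within (traverse T grp (map (\<lambda>p. (p, i)) ps) ps) (1 + length ps + 3 * size ?B)
      (\<lambda>res. distinct res \<and> set res = U)"
  proof (rule runs_within_mono)
    \<comment> \<open>Equality with the multiset of a set gives absence of duplicates and the
      element set at once.\<close>
    fix res assume "mset res = mset ps + ?B"
    then have "mset res = mset_set U" using U by simp
    then show "distinct res \<and> set res = U"
      using fin by (metis finite_set_mset_mset_set set_mset_mset distinct_count_atmost_1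
        count_mset_set(1,3) mset_set_set mset_eq_imp_distinct_iff ex_mset finite_distinct_list)
  qed simp
  then show ?thesis
    unfolding collect_descendants_def by (rule runs_within_tick) (simp add: card)
qed

end


section \<open>Number of iterations\<close>

text \<open>In this range ln (1 + y) \<ge> y - y^2 \<ge> 3y/4, while ln 2 \<le> 25/36 < 3/4. The
  bound is applied to 1/c^2, where c \<ge> 2.\<close>

lemma le_log2_one_plus:
  fixes y :: real
  assumes "0 \<le> y" "y \<le> 1 / 4"
  shows "y \<le> log 2 (1 + y)"
proof -
  have "y * y \<le> y * (1 / 4)" using assms by (intro mult_left_mono)
  have "y * ln 2 \<le> y * (25 / 36)" using assms ln2_le_25_over_36 by (intro mult_left_mono)
  also have "\<dots> \<le> y - y\<^sup>2"
    using \<open>y * y \<le> y * (1 / 4)\<close> assms by (simp add: power2_eq_square)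
  also have "\<dots> \<le> ln (1 + y)" using assms by (intro ln_one_plus_pos_lower_bound) auto
  finally show ?thesis by (simp add: log_def field_simps)
qed

context knn_problem
begin

abbreviation "c \<equiv> expansion_constant (R \<union> {q})"
abbreviation "cm \<equiv> minimized_expansion_constant R"

lemma Rq: "finite (R \<union> {q})" "R \<union> {q} \<subseteq> X"
  using finite_R R_subset q_in by auto

lemma c_ge_2: "c \<ge> 2"
  using expansion_constant_ge_2 Rq by blast

lemma cm_ge_1: "cm \<ge> 1"
  using minimized_expansion_constant_ge_1 finite_R R_subset root_in by blast

section \<open>Growth of balls around the query point\<close>

definition log_ball :: "int \<Rightarrow> real" where
  "log_ball t = log 2 (card (mcball q (2 powi t) \<inter> (R \<union> {q})))"

lemma card_ball_ge_1: "r \<ge> 0 \<Longrightarrow> 1 \<le> card (mcball q r \<inter> (R \<union> {q}))"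
proof -
  assume "r \<ge> 0"
  then have "q \<in> mcball q r \<inter> (R \<union> {q})" using q_in by (auto simp: mcball_def)
  then show ?thesis using Rq(1) by (metis One_nat_def Suc_leI card_gt_0_iff empty_iff finite_Int)
qed

lemma log_ball_mono: "s \<le> t \<Longrightarrow> log_ball s \<le> log_ball t"
proof -
  assume "s \<le> t"
  then have "(2::real) powi s \<le> 2 powi t" by (intro power_int_increasing) auto
  then have "card (mcball q (2 powi s) \<inter> (R \<union> {q})) \<le> card (mcball q (2 powi t) \<inter> (R \<union> {q}))"
    using Rq(1) by (intro card_mono) (auto simp: mcball_def)
  then show ?thesis
    unfolding log_ball_def using card_ball_ge_1[of "2 powi s"] by (intro log_mono) auto
qed

lemma log_ball_nonneg: "0 \<le> log_ball t"
  unfolding log_ball_def using card_ball_ge_1[of "2 powi t"] by simp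

lemma log_ball_le: "log_ball t \<le> 2 * log_factor (card R)"
proof -
  have "card R \<ge> 1" using k by simp
  have "card (mcball q (2 powi t) \<inter> (R \<union> {q})) \<le> card (R \<union> {q})"
    using Rq(1) by (intro card_mono) auto
  also have "\<dots> \<le> card R + 1" by (metis card_Un_le is_singletonI is_singleton_altdef)
  finally have "card (mcball q (2 powi t) \<inter> (R \<union> {q})) \<le> 2 * card R"
    using \<open>card R \<ge> 1\<close> by simp
  then have "log_ball t \<le> log 2 (2 * real (card R))"
    unfolding log_ball_def using card_ball_ge_1[of "2 powi t"] by (intro log_mono) auto
  also have "\<dots> = 1 + log 2 (card R)" using \<open>card R \<ge> 1\<close> by (simp add: log_mult)
  finally show ?thesis unfolding log_factor_def by simp
qed

text \<open>A third of the distance to \<open>x\<close> serves as radius \<open>r\<close> in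
  \<open>card_mcball_growth\<close>. Then \<open>2 powi (j - 3) \<le> r\<close> since 3 < 4, and
  \<open>4 * r \<le> 2 powi (i + 4)\<close> since 4/3 < 2. Taking logarithms turns the growth factor
  into the summand \<open>1 / c\<^sup>2\<close>.\<close>

lemma log_ball_growth:
  assumes "x \<in> R" "2 powi (j - 1) < d q x" "d q x \<le> 2 powi (i + 3)"
  shows "log_ball (j - 3) + 1 / c\<^sup>2 \<le> log_ball (i + 4)"
proof -
  define r where "r = d q x / 3"
  let ?N = "\<lambda>r. card (mcball q r \<inter> (R \<union> {q}))"
  have pos: "(0::real) < 2 powi (j - 3)" by simp
  have "(2::real) powi (j - 1) = 4 * 2 powi (j - 3)"
    using power_int_add[of "2::real" "j - 3" 2] by (simp add: ac_simps)
  then have r1: "2 powi (j - 3) \<le> r" using assms pos unfolding r_def by linarith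
  have "(2::real) powi (i + 4) = 2 * 2 powi (i + 3)"
    using power_int_add[of "2::real" "i + 3" 1] by (simp add: ac_simps)
  then have r2: "4 * r \<le> 2 powi (i + 4)" using assms unfolding r_def
    using nonneg[of q x] by linarith
  have r: "r > 0" using r1 pos by linarith
  have N1: "?N (2 powi (j - 3)) \<le> ?N r"
    using Rq(1) r1 mcball_subset_concentric[OF r1] by (intro card_mono) auto
  have N2: "?N (4 * r) \<le> ?N (2 powi (i + 4))"
    using Rq(1) mcball_subset_concentric[OF r2] by (intro card_mono) auto
  have "(1 + 1 / c\<^sup>2) * real (?N r) \<le> real (?N (4 * r))"
    using card_mcball_growth[OF Rq, of x q r] assms q_in r unfolding r_def by auto
  moreover have "(1 + 1 / c\<^sup>2) * real (?N (2 powi (j - 3))) \<le> (1 + 1 / c\<^sup>2) * real (?N r)"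
    using N1 by (intro mult_left_mono) auto
  ultimately have le: "(1 + 1 / c\<^sup>2) * real (?N (2 powi (j - 3))) \<le> real (?N (2 powi (i + 4)))"
    using N2 by linarith
  have N0: "real (?N (2 powi (j - 3))) \<ge> 1" using card_ball_ge_1[of "2 powi (j - 3)"] by simp
  have cpos: "1 + 1 / c\<^sup>2 > 0" by (simp add: add_pos_nonneg)
  have "2\<^sup>2 \<le> c\<^sup>2" using c_ge_2 by (intro power_mono) auto
  then have c: "1 / c\<^sup>2 \<le> 1 / 4" by (intro divide_left_mono) auto
  have "log 2 (1 + 1 / c\<^sup>2) + log_ball (j - 3) = log 2 ((1 + 1 / c\<^sup>2) * real (?N (2 powi (j - 3))))"
    unfolding log_ball_def using N0 cpos by (subst log_mult) auto
  also have "\<dots> \<le> log_ball (i + 4)"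
    unfolding log_ball_def using N0 cpos le by (intro log_mono) auto
  finally show ?thesis using le_log2_one_plus[of "1 / c\<^sup>2"] c by simp
qed

text \<open>The growth of balls relates scales that are up to seven levels further apart than the levels
  of consecutive iterations. Summing over a window of eight scales makes the gains telescope.\<close>

definition potential :: "int \<Rightarrow> real" where
  "potential i = log_ball (i - 3) + log_ball (i - 2) + log_ball (i - 1) + log_ball i
     + log_ball (i + 1) + log_ball (i + 2) + log_ball (i + 3) + log_ball (i + 4)"

text \<open>As j \<le> i - 1, the terms at \<open>j - 2\<close> to \<open>j + 4\<close> are
  dominated by those at \<open>i - 3\<close> to \<open>i + 3\<close>. The two unpaired terms, at
  \<open>j - 3\<close> and \<open>i + 4\<close>, provide the gain.\<close>

lemma potential_decrease:
  assumes "x \<in> R" "2 powi (j - 1) < d q x" "d q x \<le> 2 powi (i + 3)" "j < i"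
  shows "potential j + 1 / c\<^sup>2 \<le> potential i"
  unfolding potential_def
  using log_ball_growth[OF assms(1-3)] assms(4) log_ball_mono[of "j - 2" "i - 3"]
    log_ball_mono[of "j - 1" "i - 2"] log_ball_mono[of j "i - 1"] log_ball_mono[of "j + 1" i]
    log_ball_mono[of "j + 2" "i + 1"] log_ball_mono[of "j + 3" "i + 2"]
    log_ball_mono[of "j + 4" "i + 3"]
  by simp

text \<open>Scaling by \<open>c\<^sup>2\<close> turns each gain into at least one unit, so the floor
  drops strictly. This bounds the remaining jumps from above and is not their exact number.\<close>

definition iterations :: "int \<Rightarrow> nat" where
  "iterations i = nat \<lfloor>c\<^sup>2 * potential i\<rfloor>"

lemma potential_nonneg: "0 \<le> potential i"
  unfolding potential_def by (intro add_nonneg_nonneg log_ball_nonneg)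

lemma iterations_le: "real (iterations i) \<le> 16 * (c\<^sup>2 * log_factor (card R))"
proof -
  have "potential i \<le> 16 * log_factor (card R)"
    unfolding potential_def
    using log_ball_le[of "i - 3"] log_ball_le[of "i - 2"] log_ball_le[of "i - 1"] log_ball_le[of i]
      log_ball_le[of "i + 1"] log_ball_le[of "i + 2"] log_ball_le[of "i + 3"] log_ball_le[of "i + 4"]
    by simp
  then have "c\<^sup>2 * potential i \<le> c\<^sup>2 * (16 * log_factor (card R))" by (intro mult_left_mono) auto
  moreover have "real (iterations i) \<le> c\<^sup>2 * potential i"
    unfolding iterations_def using potential_nonneg[of i] by simp
  ultimately show ?thesis by simp
qed

lemma iterations_decrease:
  assumes "x \<in> R" "2 powi (j - 1) < d q x" "d q x \<le> 2 powi (i + 3)" "j < i"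
  shows "iterations j < iterations i"
proof -
  have "c\<^sup>2 * (potential j + 1 / c\<^sup>2) \<le> c\<^sup>2 * potential i"
    using potential_decrease[OF assms] by (intro mult_left_mono) auto
  then have "c\<^sup>2 * potential j + 1 \<le> c\<^sup>2 * potential i"
    using c_ge_2 by (simp add: distrib_left)
  then have "\<lfloor>c\<^sup>2 * potential j\<rfloor> + 1 \<le> \<lfloor>c\<^sup>2 * potential i\<rfloor>"
    using floor_mono[of "c\<^sup>2 * potential j + 1" "c\<^sup>2 * potential i"] by simp
  moreover have "0 \<le> \<lfloor>c\<^sup>2 * potential j\<rfloor>" using potential_nonneg[of j] by simp
  ultimately show ?thesis unfolding iterations_def by linarith
qed

text \<open>Either \<open>p\<close> or its child \<open>a\<close> serves as \<open>x\<close>. They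
  are more than \<open>2 powi j\<close> apart, so not both are within \<open>2 powi (j - 1)\<close>
  of \<open>q\<close>. If \<open>p\<close> is that close, then \<open>a\<close> is within 5 times
  \<open>2 powi (j - 1)\<close> of \<open>q\<close>, well inside the outer radius.\<close>

lemma next_level_point:
  assumes "p \<in> cover_set T i" "d q p \<le> 2 powi (i + 3)" "j < i" "a \<in> children T p" "lv a = j"
  obtains x where "x \<in> R" "2 powi (j - 1) < d q x" "d q x \<le> 2 powi (i + 3)"
proof (cases "2 powi (j - 1) < d q p")
  case True
  then show ?thesis using that[of p] assms cover_set_iff by auto
next
  case False
  note a = childD[OF assms(4)]
  have X: "a \<in> X" "p \<in> X" using a R_subset by auto
  have "2 powi j < d p a"
    using a assms by (intro cover_set_separated) (auto simp: cover_set_iff)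
  moreover have "d p a \<le> d q p + d q a" "d q a \<le> d q p + d p a"
    using X q_in triangle triangle'' by auto
  moreover have "(2::real) powi j = 2 * 2 powi (j - 1)" "(2::real) powi (j + 1) = 4 * 2 powi (j - 1)"
    "(2::real) powi (j + 4) = 32 * 2 powi (j - 1)"
    using power_int_add[of "2::real" "j - 1" 1] power_int_add[of "2::real" "j - 1" 2]
      power_int_add[of "2::real" "j - 1" 5] by (simp_all add: ac_simps)
  moreover have "(2::real) powi (j + 4) \<le> 2 powi (i + 3)"
    using assms(3) by (intro power_int_increasing) auto
  moreover have "(0::real) < 2 powi (j - 1)" by simp
  moreover have "d p a \<le> 2 powi (j + 1)" using a assms by simp
  ultimately have "2 powi (j - 1) < d q a" "d q a \<le> 2 powi (i + 3)" using False by linarith+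
  then show ?thesis using that a by blast
qed


section \<open>The search loop\<close>

abbreviation "Near \<equiv> NN d k q R"

lemma card_Near: "k \<le> card Near"
  using card_within_nn_dist[OF finite_R k] unfolding NN_def .

lemma finite_S: "p \<in> R \<Longrightarrow> finite (S i p)"
  using distinctive_descendants_subset finite_R finite_subset by metis

lemma card_UN_S:
  assumes "A \<subseteq> cover_set T i"
  shows "(\<Sum>p\<in>A. card (S i p)) = card (\<Union>p\<in>A. S i p)"
proof (rule card_UN_disjoint[symmetric])
  have "A \<subseteq> R" using assms cover_set_iff by auto
  then show "finite A" "\<forall>p\<in>A. finite (S i p)" using finite_R finite_subset finite_S by auto
  show "\<forall>p\<in>A. \<forall>p'\<in>A. p \<noteq> p' \<longrightarrow> S i p \<inter> S i p' = {}"
    using distinctive_descendants_disjoint assms by blast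
qed

lemma UN_S_subset: "A \<subseteq> cover_set T i \<Longrightarrow> (\<Union>p\<in>A. S i p) \<subseteq> R"
  using distinctive_descendants_subset cover_set_iff by blast

text \<open>The selected points suffice to reach \<open>k\<close>: either there are \<open>k\<close>
  of them, each counting at least itself, or all of \<open>C\<close> is selected and its distinctive
  descendants cover \<open>Near\<close>.\<close>

lemma scan_selected:
  assumes C: "distinct C" "set C \<subseteq> cover_set T i" "Near \<subseteq> (\<Union>p\<in>set C. S i p)"
    and sel: "nearest_entries k (map (\<lambda>p. (d q p, p)) C) sel"
  shows "runs_within (scan_sizes T i k 0 sel) (length C)
    (\<lambda>e. is_lambda_point d T k q i (set C) (snd e) \<and> fst e = d q (snd e))"
proof -
  note D = nearest_entriesD[where d = d and q = q, OF C(1) sel]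
  let ?w = "\<lambda>e. card (S i (snd e))"
  have "C \<noteq> []" using C(3) card_Near k(1) by auto
  then have "sel \<noteq> []" using D(5) k(1) by (auto simp: min_def split: if_splits)
  have sum: "sum_list (map ?w sel) = (\<Sum>p\<in>snd ` set sel. card (S i p))"
    using sum_list_distinct_conv_sum_set[OF D(2), of "\<lambda>p. card (S i p)"] by (simp add: comp_def)
  have sub: "snd ` set sel \<subseteq> set C" using D(3) by auto
  have "k \<le> sum_list (map ?w sel)"
  proof (cases "length sel = k")
    case True
    have "card (S i p) \<ge> 1" if "p \<in> snd ` set sel" for p
    proof -
      have "p \<in> cover_set T i" using that sub C(2) by blast
      then have "p \<in> R" "i \<le> lv p" using cover_set_iff by auto
      then have "p \<in> S i p" using distinctive_descendants_eq by auto
      then show ?thesis using finite_S[OF \<open>p \<in> R\<close>] card_gt_0_iff by (metis One_nat_def Suc_leI empty_iff)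
    qed
    then have "card (snd ` set sel) \<le> sum_list (map ?w sel)"
      unfolding sum using sum_mono[of "snd ` set sel" "\<lambda>_. 1" "\<lambda>p. card (S i p)"] by simp
    then show ?thesis using distinct_card[OF D(2)] True by simp
  next
    case False
    then have "card (snd ` set sel) = card (set C)"
      using D(5) distinct_card[OF D(2)] distinct_card[OF C(1)] by simp
    then have "snd ` set sel = set C" using sub by (intro card_subset_eq) auto
    then have "sum_list (map ?w sel) = card (\<Union>p\<in>set C. S i p)"
      using sum card_UN_S[OF C(2)] by simp
    also have "\<dots> \<ge> card Near"
      by (rule card_mono[OF finite_subset[OF UN_S_subset[OF C(2)] finite_R] C(3)])
    finally show ?thesis using card_Near by simp
  qed
  then have run: "runs_within (scan_sizes T i k 0 sel) (length sel) (\<lambda>_. True)"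
    using \<open>sel \<noteq> []\<close> by (intro scan_sizes_succeeds) auto
  then obtain e t where e: "scan_sizes T i k 0 sel = Some (e, t)" "t \<le> length sel"
    unfolding runs_within_def by auto
  have "is_lambda_point d T k q i (set C) (snd e) \<and> fst e = d q (snd e)"
    by (rule scan_sizes_lambda_point[where d = d and q = q, OF _ D(1-4) e(1)]) simp
  then show ?thesis using e D(5) unfolding runs_within_def by auto
qed

lemma lambda_pointD:
  assumes C: "C \<subseteq> cover_set T i" "Near \<subseteq> (\<Union>p\<in>C. S i p)"
    and x: "is_lambda_point d T k q i C x"
  shows lambda_point_covers:
      "Near \<subseteq> (\<Union>p\<in>{p \<in> C. d q p \<le> d q x + 2 powi (i + 2)}. S i p)"
    and lambda_point_collected: "d q x > 2 powi (i + 2) \<Longrightarrow>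
      real (card (\<Union>p\<in>{p \<in> C. d q p \<le> d q x + 2 powi (i + 2)}. S i p)) \<le> c ^ 3 * k"
proof -
  let ?\<rho> = "nn_dist d k q R"
  have CR: "C \<subseteq> R" using C cover_set_iff by auto
  have x1: "x \<in> C" "k \<le> (\<Sum>p \<in> {p \<in> C. d q p \<le> d q x}. card (S i p))"
    and x2: "\<And>y. y \<in> C \<Longrightarrow> d q y < d q x \<Longrightarrow>
      (\<Sum>p \<in> {p \<in> C. d q p \<le> d q y}. card (S i p)) < k"
    using x unfolding is_lambda_point_def is_arg_min_def by (auto simp: not_le)
  have pw: "(2::real) powi (i + 2) = 2 * 2 powi (i + 1)"
    using power_int_add[of "2::real" "i + 1" 1] by (simp add: ac_simps)
  have pos: "(0::real) < 2 powi (i + 1)" by simp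
  have dist: "d q u \<le> d q p + 2 powi (i + 1)" "d q p \<le> d q u + 2 powi (i + 1)"
    if "p \<in> C" "u \<in> S i p" for p u
  proof -
    have "p \<in> X" "u \<in> X" using that CR R_subset distinctive_descendants_subset by blast+
    moreover have "d p u \<le> 2 powi (i + 1)" using distinctive_descendants_dist C that by blast
    ultimately show "d q u \<le> d q p + 2 powi (i + 1)" "d q p \<le> d q u + 2 powi (i + 1)"
      using triangle[of q p u] triangle'[of q u p] q_in by auto
  qed
  have "k \<le> card (\<Union>p\<in>{p \<in> C. d q p \<le> d q x}. S i p)"
  proof -
    have "{p \<in> C. d q p \<le> d q x} \<subseteq> cover_set T i" using C(1) by blast
    from card_UN_S[OF this] show ?thesis using x1(2) by linarith
  qed
  also have "\<dots> \<le> card {u \<in> R. d q u \<le> d q x + 2 powi (i + 1)}"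
    using finite_R CR distinctive_descendants_subset dist(1) by (intro card_mono) fastforce+
  finally have \<rho>: "?\<rho> \<le> d q x + 2 powi (i + 1)" by (rule nn_dist_le[OF finite_R k(1)])
  show "Near \<subseteq> (\<Union>p\<in>{p \<in> C. d q p \<le> d q x + 2 powi (i + 2)}. S i p)"
  proof
    fix u assume u: "u \<in> Near"
    then obtain p where p: "p \<in> C" "u \<in> S i p" using C by auto
    then have "d q p \<le> d q x + 2 powi (i + 2)"
      using dist(2)[OF p] u \<rho> pw unfolding NN_def by auto
    then show "u \<in> (\<Union>p\<in>{p \<in> C. d q p \<le> d q x + 2 powi (i + 2)}. S i p)" using p by auto
  qed
  assume far: "d q x > 2 powi (i + 2)"
  let ?U = "\<Union>p\<in>{p \<in> C. d q p \<le> d q x + 2 powi (i + 2)}. S i p"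
  \<comment> \<open>Otherwise the \<open>k\<close> nearest neighbors would all descend from points
    \<open>p\<close> with \<open>d q p \<le> d q x / 2 + 2 powi (i + 1) < d q x\<close>, the last
    step by \<open>far\<close>. The farthest such \<open>p\<close> would then contradict the
    minimality of the \<lambda>-point.\<close>
  have few: "card {u \<in> R. d q u \<le> d q x / 2} < k"
  proof (rule ccontr)
    assume "\<not> card {u \<in> R. d q u \<le> d q x / 2} < k"
    then have "k \<le> card {u \<in> R. d q u \<le> d q x / 2}" by (simp only: not_less)
    then have \<rho>': "?\<rho> \<le> d q x / 2" by (rule nn_dist_le[OF finite_R k(1)])
    let ?D = "{p \<in> C. d q p < d q x}"
    have Near: "Near \<subseteq> (\<Union>p\<in>?D. S i p)"
    proof
      fix u assume u: "u \<in> Near"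
      then obtain p where p: "p \<in> C" "u \<in> S i p" using C by auto
      have "d q u \<le> d q x / 2" using u \<rho>' unfolding NN_def by auto
      then have "d q p < d q x" using dist(2)[OF p] far pw by linarith
      then show "u \<in> (\<Union>p\<in>?D. S i p)" using p by auto
    qed
    have finD: "finite ?D" using finite_subset[OF CR finite_R] by simp
    have "Near \<noteq> {}" using card_Near k(1) by auto
    then have "?D \<noteq> {}" using Near by auto
    then have "Max (d q ` ?D) \<in> d q ` ?D" using finD by (intro Max_in) auto
    then obtain y where y: "y \<in> ?D" "d q y = Max (d q ` ?D)" by auto
    have "{p \<in> C. d q p \<le> d q y} = ?D" using y finD by auto
    then have "(\<Sum>p \<in> ?D. card (S i p)) < k" using x2[of y] y(1) by auto
    moreover have "?D \<subseteq> cover_set T i" using C(1) by blast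
    ultimately have "card (\<Union>p\<in>?D. S i p) < k" using card_UN_S[of ?D i] by linarith
    moreover have "card Near \<le> card (\<Union>p\<in>?D. S i p)"
      using Near UN_S_subset[of ?D i] C finite_R by (intro card_mono) (auto intro: finite_subset)
    ultimately show False using card_Near by simp
  qed
  \<comment> \<open>Distances here are at most
    \<open>d q x + 2 powi (i + 2) + 2 powi (i + 1)\<close>, less than 5/2 times
    \<open>d q x\<close>. Rounding up to 4 times makes the radius three doublings of
    \<open>d q x / 2\<close>.\<close>
  have "?U \<subseteq> mcball q (2 ^ 3 * (d q x / 2)) \<inter> (R \<union> {q})"
  proof
    fix u assume "u \<in> ?U"
    then obtain p where p: "p \<in> C" "d q p \<le> d q x + 2 powi (i + 2)" "u \<in> S i p" by auto
    have "u \<in> R" using p CR distinctive_descendants_subset by blast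
    moreover have "d q u \<le> 4 * d q x" using dist(1)[OF p(1,3)] p(2) far pw pos by linarith
    ultimately show "u \<in> mcball q (2 ^ 3 * (d q x / 2)) \<inter> (R \<union> {q})"
      using q_in R_subset by (auto simp: mcball_def)
  qed
  then have "card ?U \<le> card (mcball q (2 ^ 3 * (d q x / 2)) \<inter> (R \<union> {q}))"
    using Rq(1) by (intro card_mono) auto
  then have "real (card ?U) \<le> real (card (mcball q (2 ^ 3 * (d q x / 2)) \<inter> (R \<union> {q})))" by simp
  also have "\<dots> \<le> c ^ 3 * real (card (mcball q (d q x / 2) \<inter> (R \<union> {q})))"
    using card_mcball_power[OF Rq, of q "d q x / 2" 3] by simp
  also have "\<dots> \<le> c ^ 3 * k"
  proof -
    \<comment> \<open>Fewer than \<open>k\<close> points of \<open>R\<close> plus possibly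
      \<open>q\<close> itself make at most \<open>k\<close>.\<close>
    have "mcball q (d q x / 2) \<inter> (R \<union> {q}) \<subseteq> insert q {u \<in> R. d q u \<le> d q x / 2}"
      by (auto simp: mcball_def)
    then have "card (mcball q (d q x / 2) \<inter> (R \<union> {q})) \<le> card (insert q {u \<in> R. d q u \<le> d q x / 2})"
      using finite_R by (intro card_mono) auto
    also have "\<dots> \<le> Suc (card {u \<in> R. d q u \<le> d q x / 2})" by (rule card_insert_le_m1) auto
    finally show ?thesis using few c_ge_2 by (intro mult_left_mono) auto
  qed
  finally show "real (card ?U) \<le> c ^ 3 * k" .
qed

text \<open>The members of \<open>R\<^bsub>i\<^sup>+\<^esub>\<close> have no children at the levels strictly between \<open>i\<close> and \<open>i\<^sup>+\<close>, so
  their distinctive descendant sets at the levels \<open>i + 1\<close> and \<open>i\<^sup>+\<close> agree. This is why the loop need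
  not remember \<open>i\<^sup>+\<close>.\<close>

definition loop_inv :: "int \<Rightarrow> 'a list \<Rightarrow> bool" where
  "loop_inv i ps \<longleftrightarrow> distinct ps \<and> set ps \<subseteq> cover_set T (i + 1) \<and>
     Near \<subseteq> (\<Union>p\<in>set ps. S (i + 1) p) \<and> real (length ps) \<le> cm ^ 6"

lemma set_with_children:
  "set ps \<subseteq> R \<Longrightarrow> set (concat (map (\<lambda>p. p # grp p i) ps)) =
    set ps \<union> (\<Union>p\<in>set ps. {a \<in> children T p. lv a = i})"
  using grp(2) by (induction ps) auto

text \<open>Members of \<open>ps\<close> have level at least \<open>i + 1\<close> and so differ from
  the added children; groups of different parents are disjoint because parents are unique.\<close>

lemma distinct_with_children:
  assumes "distinct ps" "set ps \<subseteq> cover_set T (i + 1)"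
  shows "distinct (concat (map (\<lambda>p. p # grp p i) ps))"
  using assms
proof (induction ps)
  case (Cons p ps)
  have ps: "p \<in> R" "set ps \<subseteq> R" using Cons.prems cover_set_iff by auto
  have high: "lv p' \<noteq> i" if "p' \<in> set (p # ps)" for p' using that Cons.prems cover_set_iff by force
  note set = set_with_children[OF ps(2), of i]
  have "p \<notin> set (grp p i)" using grp(2)[OF ps(1)] high[of p] by auto
  moreover have "p \<notin> set (concat (map (\<lambda>p. p # grp p i) ps))"
    unfolding set using Cons.prems high[of p] by auto
  moreover have "set (grp p i) \<inter> set (concat (map (\<lambda>p. p # grp p i) ps)) = {}"
  proof (rule ccontr)
    assume "\<not> ?thesis"
    then obtain a where a: "a \<in> children T p" "lv a = i"
        "a \<in> set ps \<or> (\<exists>p'\<in>set ps. a \<in> children T p')"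
      unfolding set grp(2)[OF ps(1)] by blast
    then obtain p' where "p' \<in> set ps" "a \<in> children T p'" using high by auto
    then show False using childD(5) a(1) Cons.prems(1) by (metis distinct.simps(2))
  qed
  ultimately show ?case using Cons grp(1)[OF ps(1)] by auto
qed simp

lemma with_children:
  assumes inv: "loop_inv i ps"
  defines "C \<equiv> concat (map (\<lambda>p. p # grp p i) ps)"
  shows "distinct C" "set C \<subseteq> cover_set T i" "Near \<subseteq> (\<Union>p\<in>set C. S i p)"
    "real (length C) \<le> cm ^ 10"
proof -
  have ps: "distinct ps" "set ps \<subseteq> cover_set T (i + 1)" "set ps \<subseteq> R"
    "Near \<subseteq> (\<Union>p\<in>set ps. S (i + 1) p)" "real (length ps) \<le> cm ^ 6"
    using inv cover_set_iff unfolding loop_inv_def by auto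
  show "distinct C" unfolding C_def by (rule distinct_with_children[OF ps(1,2)])
  have set: "set C = set ps \<union> (\<Union>p\<in>set ps. {a \<in> children T p. lv a = i})"
    unfolding C_def by (rule set_with_children[OF ps(3)])
  show "set C \<subseteq> cover_set T i"
    unfolding set using ps(2) childD(1) by (auto simp: cover_set_iff subset_iff)
  have "(\<Union>p\<in>set ps. S (i + 1) p) \<subseteq> (\<Union>p\<in>set C. S i p)"
    unfolding set using distinctive_descendants_descend[of _ i] ps(2) by fastforce
  then show "Near \<subseteq> (\<Union>p\<in>set C. S i p)" using ps(4) by blast
  have "real (length (p # grp p i)) \<le> cm ^ 4" if "p \<in> set ps" for p
  proof -
    have p: "p \<in> R" "p \<in> cover_set T i" "lv p \<noteq> i"
      using that ps(2) by (force simp: cover_set_iff)+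
    have "length (p # grp p i) = card (set (p # grp p i))"
      using distinct_card[of "p # grp p i"] grp[OF p(1)] p(3) by auto
    also have "set (p # grp p i) = insert p {a \<in> children T p. lv a = i}" using grp[OF p(1)] by auto
    finally show ?thesis using card_children_level_le[OF p(2)] by simp
  qed
  then have "(\<Sum>p\<leftarrow>ps. real (length (p # grp p i))) \<le> (\<Sum>p\<leftarrow>ps. cm ^ 4)"
    by (intro sum_list_mono) auto
  also have "\<dots> = real (length ps) * cm ^ 4" by (simp add: sum_list_triv)
  also have "\<dots> \<le> cm ^ 6 * cm ^ 4" using ps(5) cm_ge_1 by (intro mult_right_mono) auto
  also have "\<dots> = cm ^ 10" by (simp flip: power_add)
  also have "(\<Sum>p\<leftarrow>ps. real (length (p # grp p i))) = real (length C)"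
    unfolding C_def by (induction ps) auto
  finally show "real (length C) \<le> cm ^ 10" .
qed

lemma loop_inv_next:
  assumes i: "l_min T \<le> i"
    and ps: "distinct ps" "set ps \<subseteq> cover_set T i" "Near \<subseteq> (\<Union>p\<in>set ps. S i p)"
    and near: "\<And>p. p \<in> set ps \<Longrightarrow> d q p \<le> 2 powi (i + 3)"
  defines "j \<equiv> Max ((\<lambda>p. Next T p i) ` set ps)"
  shows "loop_inv j ps" "j < i" "l_min T \<le> j \<Longrightarrow> iterations j < iterations i"
proof -
  have "Near \<noteq> {}" using card_Near k(1) by auto
  then have "j \<in> (\<lambda>p. Next T p i) ` set ps"
    unfolding j_def using ps(3) by (intro Max_in) auto
  then obtain p where p: "p \<in> set ps" "j = Next T p i" by auto
  show "j < i" using Next_props(1)[of p i] i p(2) by auto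
  have j: "Next T p' i \<le> j" if "p' \<in> set ps" for p' unfolding j_def using that by auto
  \<comment> \<open>Since \<open>j\<close> is the maximum of all \<open>Next\<close> values, no
    member has a child strictly between the levels \<open>j\<close> and \<open>i\<close>.\<close>
  have "S (j + 1) p' = S i p'" if "p' \<in> set ps" for p'
    using ps(2) that \<open>j < i\<close> j[OF that] Next_props(3)[of _ p' i]
    by (intro distinctive_descendants_skip) force+
  then have "Near \<subseteq> (\<Union>p\<in>set ps. S (j + 1) p)" using ps(3) by auto
  moreover have "set ps \<subseteq> cover_set T (j + 1)" using ps(2) \<open>j < i\<close> by (auto simp: cover_set_iff)
  moreover have "real (length ps) \<le> cm ^ 6"
    using card_cover_set_ball_le[OF ps(2) q_in near] distinct_card[OF ps(1)] by simp
  ultimately show "loop_inv j ps" unfolding loop_inv_def using ps(1) by simp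
  \<comment> \<open>Only then is \<open>j\<close> the level of an actual child, which yields the
    point needed for growth. Below \<open>l_min T\<close> the loop ends and no decrease is
    claimed.\<close>
  assume "l_min T \<le> j"
  then obtain a where a: "a \<in> children T p" "lv a = j" using Next_props(4)[of p i] p(2) by auto
  then obtain x where x: "x \<in> R" "2 powi (j - 1) < d q x" "d q x \<le> 2 powi (i + 3)"
    using next_level_point[of p i j a] ps(2) p(1) near \<open>j < i\<close> by blast
  show "iterations j < iterations i" by (rule iterations_decrease[OF x \<open>j < i\<close>])
qed

section \<open>Cost of the search loop\<close>

definition level_cost :: nat where
  "level_cost = 16 * (heap_height_bound k * nat \<lfloor>cm ^ 10\<rfloor>)"

definition final_cost :: nat where
  "final_cost = 16 * (heap_height_bound k * nat \<lfloor>c ^ 3 * k\<rfloor>)"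

text \<open>The factor 16 is 13 + 3: since the heap height bound is at least 1, work linear in
  \<open>m\<close> is absorbed into the heap work.\<close>

lemma linear_cost_le:
  assumes "1 \<le> m" "real m \<le> B" "a \<le> 13"
  shows "a * m + 3 * (heap_height_bound k * m) \<le> 16 * (heap_height_bound k * nat \<lfloor>B\<rfloor>)"
proof -
  have "m \<le> nat \<lfloor>B\<rfloor>" using assms(2) by (simp add: le_nat_floor)
  then have "heap_height_bound k * m \<le> heap_height_bound k * nat \<lfloor>B\<rfloor>" by simp
  moreover have "1 * m \<le> heap_height_bound k * m"
    using heap_height_bound_ge[OF k(1)] by (intro mult_right_mono) auto
  moreover have "a * m \<le> 13 * m" using assms(3) by simp
  ultimately show ?thesis by linarith
qed

text \<open>The summand 2 pays for the current iteration, which occurs even if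
  \<open>iterations i\<close> is 0, and for the output after the level has dropped below
  \<open>l_min T\<close>.\<close>

lemma knn_loop_correct:
  assumes "loop_inv i ps"
  shows "runs_within (knn_loop d T grp q k i ps)
    (if i < l_min T then level_cost else level_cost * (iterations i + 2) + final_cost)
    (all_k_nearest_neighbors d k q R)"
  using assms
proof (induction "nat (i - l_min T + 1)" arbitrary: i ps rule: less_induct)
  case less
  let ?H = "heap_height_bound k"
  show ?case
  proof (cases "i < l_min T")
    case True
    have ps: "distinct ps" "set ps \<subseteq> cover_set T (i + 1)" "set ps \<subseteq> R"
      "Near \<subseteq> (\<Union>p\<in>set ps. S (i + 1) p)" "real (length ps) \<le> cm ^ 6"
      using less.prems cover_set_iff unfolding loop_inv_def by auto
    have "S (i + 1) p = {p}" if "p \<in> set ps" for p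
      using distinctive_descendants_below_l_min[of p "i + 1"] that ps(2) True by auto
    then have sub: "Near \<subseteq> set ps" using ps(4) by auto
    then have "1 \<le> length ps" using card_Near k(1) by (cases ps) auto
    have "cm ^ 6 \<le> cm ^ 10" using cm_ge_1 by (intro power_increasing) auto
    then have "9 * length ps + 3 * (?H * length ps) \<le> level_cost"
      unfolding level_cost_def using ps(5) \<open>1 \<le> length ps\<close> by (intro linear_cost_le) auto
    then have cost: "1 + (2 + length ps * (3 * ?H + 6)) \<le> level_cost"
      using \<open>1 \<le> length ps\<close> by (simp add: algebra_simps)
    show ?thesis
      using True cost
      by (subst knn_loop.simps)
        (auto intro!: runs_within_tick output_nearest_correct finite_R k ps sub)
  next
    case False
    define C where "C = concat (map (\<lambda>p. p # grp p i) ps)"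
    let ?es = "map (\<lambda>p. (d q p, p)) C" and ?m = "length C"
    note C = with_children[OF less.prems, folded C_def]
    have "C \<noteq> []" using C(3) card_Near k(1) by auto
    then have m: "1 \<le> ?m" by (cases C) auto
    let ?rest = "level_cost * (iterations i + 1) + final_cost"
    let ?all = "all_k_nearest_neighbors d k q R"
    \<comment> \<open>The loop body after the scan, as a function of the entry found. The bounds are
      assembled from the inside outwards.\<close>
    define tail where "tail = (\<lambda>e :: real \<times> 'a. timed_bind (entries_within (fst e + 2 powi (i + 2)) ?es)
      (\<lambda>Ri. if 2 powi (i + 2) < fst e
         then timed_bind (collect_descendants T grp i Ri) (output_nearest d q k)
         else timed_bind (max_Next T i Ri) (\<lambda>j. knn_loop d T grp q k j Ri)))"
    have tail: "runs_within (tail e) (?m + (?m + ?rest)) ?all"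
      if e: "is_lambda_point d T k q i (set C) (snd e) \<and> fst e = d q (snd e)" for e
    proof -
      let ?lam = "d q (snd e)"
      define Ri where "Ri = filter (\<lambda>p. d q p \<le> ?lam + 2 powi (i + 2)) C"
      have set_Ri: "set Ri = {p \<in> set C. d q p \<le> ?lam + 2 powi (i + 2)}" unfolding Ri_def by auto
      note L = lambda_pointD[OF C(2,3) conjunct1[OF e], folded set_Ri]
      have Ri: "distinct Ri" "set Ri \<subseteq> cover_set T i" "length Ri \<le> ?m"
        using C(1,2) unfolding Ri_def by auto
      have branch: "runs_within (if 2 powi (i + 2) < ?lam
          then timed_bind (collect_descendants T grp i Ri) (output_nearest d q k)
          else timed_bind (max_Next T i Ri) (\<lambda>j. knn_loop d T grp q k j Ri)) (?m + ?rest) ?all"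
      proof (cases "2 powi (i + 2) < ?lam")
        case far: True
        define U where "U = (\<Union>p\<in>set Ri. S i p)"
        have U: "Near \<subseteq> U" "real (card U) \<le> c ^ 3 * k" "U \<subseteq> R"
          using L far UN_S_subset[OF Ri(2)] unfolding U_def by auto
        have "card Near \<le> card U" using U finite_R by (intro card_mono) (auto intro: finite_subset)
        then have U1: "1 \<le> card U" using card_Near k(1) by simp
        have "12 * card U + 3 * (?H * card U) \<le> final_cost"
          unfolding final_cost_def using U(2) U1 by (intro linear_cost_le) auto
        then have cost: "1 + 3 * card U + (2 + card U * (3 * ?H + 6)) \<le> final_cost"
          using U1 by (simp add: algebra_simps)
        have "runs_within (timed_bind (collect_descendants T grp i Ri) (output_nearest d q k))
            (1 + 3 * card U + (2 + card U * (3 * ?H + 6))) ?all"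
        proof (rule runs_within_bind[OF collect_descendants_correct[OF Ri(1,2), folded U_def]],
            elim conjE)
          fix us assume us: "distinct us" "set us = U"
          then have "length us = card U" using distinct_card by metis
          then show "runs_within (output_nearest d q k us) (2 + card U * (3 * ?H + 6)) ?all"
            using output_nearest_correct[OF finite_R k us(1)] us U by metis
        qed
        then have "runs_within (timed_bind (collect_descendants T grp i Ri) (output_nearest d q k))
            (?m + ?rest) ?all"
          by (rule runs_within_mono) (use cost in auto)
        then show ?thesis using far by simp
      next
        case near: False
        define j where "j = Max ((\<lambda>p. Next T p i) ` set Ri)"
        have "d q p \<le> 2 powi (i + 3)" if "p \<in> set Ri" for p
        proof -
          have "(2::real) powi (i + 3) = 2 * 2 powi (i + 2)"
            using power_int_add[of "2::real" "i + 2" 1] by (simp add: ac_simps)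
          then show ?thesis using that near unfolding set_Ri by auto
        qed
        note J = loop_inv_next[OF _ Ri(1,2) L(1) this, folded j_def]
        have "l_min T \<le> i" using False by simp
        have "runs_within (knn_loop d T grp q k j Ri)
          (if j < l_min T then level_cost else level_cost * (iterations j + 2) + final_cost) ?all"
          using J(1,2)[OF \<open>l_min T \<le> i\<close>] False by (intro less.hyps) auto
        then have rec: "runs_within (knn_loop d T grp q k j Ri) ?rest ?all"
        proof (rule runs_within_mono)
          \<comment> \<open>The strict drop of \<open>iterations\<close> leaves one
            \<open>level_cost\<close> over for the current iteration.\<close>
          show "(if j < l_min T then level_cost else level_cost * (iterations j + 2) + final_cost) \<le> ?rest"
          proof (cases "j < l_min T")
            case False
            then have "iterations j + 2 \<le> iterations i + 1" using J(3)[OF \<open>l_min T \<le> i\<close>] by simp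
            then have "level_cost * (iterations j + 2) \<le> level_cost * (iterations i + 1)"
              by (rule mult_le_mono2)
            then show ?thesis using False by simp
          qed simp
        qed
        have "runs_within (timed_bind (max_Next T i Ri) (\<lambda>j. knn_loop d T grp q k j Ri))
            (length Ri + ?rest) ?all"
          using rec by (intro runs_within_bind[OF max_Next_correct]) (simp add: j_def)
        then show ?thesis using near Ri(3) by (auto intro: runs_within_mono)
      qed
      have Ri_eq: "map snd (filter (\<lambda>e'. fst e' \<le> fst e + 2 powi (i + 2)) ?es) = Ri"
        using e unfolding Ri_def by (simp add: filter_map comp_def)
      have "runs_within (tail e) (length ?es + (?m + ?rest)) ?all"
        unfolding tail_def
      proof (rule runs_within_bind[OF entries_within_correct], unfold Ri_eq, hypsubst)
        show "runs_within (if 2 powi (i + 2) < fst e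
          then timed_bind (collect_descendants T grp i Ri) (output_nearest d q k)
          else timed_bind (max_Next T i Ri) (\<lambda>j. knn_loop d T grp q k j Ri)) (?m + ?rest) ?all"
          unfolding conjunct2[OF e] by (rule branch)
      qed
      then show ?thesis by simp
    qed
    have sel: "runs_within (timed_bind (scan_sizes T i k 0 sel) tail) (?m + (?m + (?m + ?rest))) ?all"
      if "nearest_entries k ?es sel" for sel
      by (rule runs_within_bind[OF scan_selected[OF C(1-3) that] tail])
    have "runs_within (timed_bind (select_nearest k ?es) (\<lambda>sel. timed_bind (scan_sizes T i k 0 sel) tail))
       (2 + length ?es * (3 * ?H + 4) + (?m + (?m + (?m + ?rest)))) ?all"
      by (rule runs_within_bind[OF select_nearest_correct[OF k(1)] sel])
    then have es: "runs_within (timed_bind (with_distances d q C) (\<lambda>es. timed_bind (select_nearest k es)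
         (\<lambda>sel. timed_bind (scan_sizes T i k 0 sel)
           (\<lambda>e. timed_bind (entries_within (fst e + 2 powi (i + 2)) es)
      (\<lambda>Ri. if 2 powi (i + 2) < fst e
         then timed_bind (collect_descendants T grp i Ri) (output_nearest d q k)
         else timed_bind (max_Next T i Ri) (\<lambda>j. knn_loop d T grp q k j Ri))))))
       (?m + (2 + length ?es * (3 * ?H + 4) + (?m + (?m + (?m + ?rest))))) ?all"
      unfolding tail_def by (intro runs_within_bind[OF with_distances_correct]) simp
    have body: "runs_within (timed_bind (add_children grp i ps) (\<lambda>C. timed_bind (with_distances d q C)
         (\<lambda>es. timed_bind (select_nearest k es)
         (\<lambda>sel. timed_bind (scan_sizes T i k 0 sel)
           (\<lambda>e. timed_bind (entries_within (fst e + 2 powi (i + 2)) es)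
      (\<lambda>Ri. if 2 powi (i + 2) < fst e
         then timed_bind (collect_descendants T grp i Ri) (output_nearest d q k)
         else timed_bind (max_Next T i Ri) (\<lambda>j. knn_loop d T grp q k j Ri)))))))
       (1 + ?m + (?m + (2 + length ?es * (3 * ?H + 4) + (?m + (?m + (?m + ?rest)))))) ?all"
      using es by (intro runs_within_bind[OF add_children_correct[of grp i ps, folded C_def]]) simp
    \<comment> \<open>One iteration costs 9 units per candidate besides the heap work, and 4 units
      in addition, which \<open>1 \<le> ?m\<close> absorbs.\<close>
    have "13 * ?m + 3 * (?H * ?m) \<le> level_cost"
      unfolding level_cost_def using C(4) m by (intro linear_cost_le) auto
    then have "1 + (1 + ?m + (?m + (2 + length ?es * (3 * ?H + 4) + (?m + (?m + (?m + ?rest))))))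
        \<le> level_cost + ?rest"
      using m by (simp add: algebra_simps)
    also have "\<dots> = level_cost * (iterations i + 2) + final_cost" by simp
    finally show ?thesis
      using False
      by (subst knn_loop.simps) (simp add: runs_within_tick[OF body])
  qed
qed

text \<open>The heap height bound is at most twice the logarithmic factor, so
  \<open>level_cost\<close> carries the factor 32, and \<open>iterations i + 2\<close> carries 16 +
  2 = 18. With the single first unit this gives 32 * 18 + 1 = 577, and 32 for
  \<open>final_cost\<close>.\<close>

lemma costs_le:
  "real (1 + (level_cost * (iterations i + 2) + final_cost)) \<le>
    time_constant * (c\<^sup>2 * log_factor k * (cm ^ 10 * log_factor (card R) + c * k))"
proof -
  define H where "H = real (heap_height_bound k)"
  define lk where "lk = log_factor k"
  define L where "L = log_factor (card R)"
  define W where "W = cm ^ 10"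
  have H: "H \<le> 2 * lk" "0 \<le> H"
    unfolding H_def lk_def using heap_height_bound_log_factor[OF k(1)] by auto
  have lk: "1 \<le> lk" "1 \<le> L" unfolding lk_def L_def log_factor_def by auto
  have W: "1 \<le> W" unfolding W_def using cm_ge_1 by simp
  have "2\<^sup>2 \<le> c\<^sup>2" using c_ge_2 by (intro power_mono) auto
  then have c2: "4 \<le> c\<^sup>2" by simp
  have k1: "1 \<le> real k" using k(1) by simp
  have "1 * 1 \<le> c\<^sup>2 * L" using c2 lk by (intro mult_mono) auto
  then have it: "real (iterations i + 2) \<le> 18 * (c\<^sup>2 * L)"
    using iterations_le[of i] unfolding L_def[symmetric] by simp
  have "real (nat \<lfloor>W\<rfloor>) \<le> W" "real (nat \<lfloor>c ^ 3 * k\<rfloor>) \<le> c ^ 3 * k"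
    using W c_ge_2 by simp_all
  then have "real level_cost \<le> 16 * (2 * lk * W)" "real final_cost \<le> 16 * (2 * lk * (c ^ 3 * k))"
    unfolding level_cost_def final_cost_def W_def[symmetric] of_nat_mult H_def[symmetric] of_nat_numeral
    using H W lk by (intro mult_left_mono mult_mono; simp)+
  moreover have "real level_cost * real (iterations i + 2) \<le> 16 * (2 * lk * W) * (18 * (c\<^sup>2 * L))"
    using calculation(1) it lk W by (intro mult_mono) auto
  moreover have "1 * 1 * 1 * 1 \<le> c\<^sup>2 * lk * W * L"
    using c2 lk W by (intro mult_mono mult_nonneg_nonneg) auto
  ultimately have "real (1 + (level_cost * (iterations i + 2) + final_cost)) \<le>
      577 * (c\<^sup>2 * lk * W * L) + 32 * (c ^ 3 * lk * k)"
    by (simp add: algebra_simps)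
  also have "\<dots> \<le> time_constant * (c\<^sup>2 * lk * W * L) + time_constant * (c ^ 3 * lk * k)"
    using lk W c_ge_2 unfolding time_constant_def
    by (intro add_mono mult_right_mono mult_nonneg_nonneg) auto
  also have "\<dots> = time_constant * (c\<^sup>2 * lk * (W * L + c * k))"
    by (simp add: algebra_simps power2_eq_square power3_eq_cube)
  finally show ?thesis unfolding lk_def L_def W_def .
qed

lemma knn_correct:
  "\<exists>us time. knn d T grp q k = Some (us, time) \<and> all_k_nearest_neighbors d k q R us \<and>
     real time \<le> time_constant * (c\<^sup>2 * log_factor k * (cm ^ 10 * log_factor (card R) + c * k))"
proof -
  let ?n = "1 + (level_cost * (iterations (l_max T - 1) + 2) + final_cost)"
  have "runs_within (knn d T grp q k) ?n (all_k_nearest_neighbors d k q R)"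
  proof (cases "R = {root_of T}")
    case True
    then have "k = 1" using k by (metis One_nat_def card.empty card.insert empty_iff finite.emptyI le_antisym)
    then have "all_k_nearest_neighbors d k q R [root_of T]"
      using True unfolding all_k_nearest_neighbors_def NN_def nn_dist_def sorted_distances_def by simp
    then show ?thesis
      unfolding knn_def verts_eq using True
      by (auto intro!: runs_within_tick[where n = 0])
  next
    case False
    have "l_min T \<le> l_max T - 1"
    proof -
      obtain x where "x \<in> R" "x \<noteq> root_of T" using False root_in by auto
      then have "lv x \<le> Max (lv ` (verts T - {root_of T}))" using finite_R verts_eq by (intro Max_ge) auto
      then show ?thesis using l_min_le[OF \<open>x \<in> R\<close>] unfolding l_max_def by simp
    qed
    \<comment> \<open>At level \<open>l_max T\<close> the distinctive descendants of the root are
      all of \<open>R\<close>.\<close>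
    moreover have "loop_inv (l_max T - 1) [root_of T]"
      using distinctive_descendants_root[OF False] cm_ge_1 unfolding loop_inv_def NN_def by auto
    ultimately have "runs_within (knn_loop d T grp q k (l_max T - 1) [root_of T])
        (level_cost * (iterations (l_max T - 1) + 2) + final_cost) (all_k_nearest_neighbors d k q R)"
      using knn_loop_correct[of "l_max T - 1" "[root_of T]"] by simp
    then show ?thesis
      unfolding knn_def verts_eq if_not_P[OF False] by (rule runs_within_tick) simp
  qed
  then obtain us t where "knn d T grp q k = Some (us, t)" "t \<le> ?n" "all_k_nearest_neighbors d k q R us"
    unfolding runs_within_def by auto
  moreover have "real t \<le> real ?n" using \<open>t \<le> ?n\<close> by (rule of_nat_mono)
  ultimately show ?thesis using costs_le[of "l_max T - 1"] order_trans by blast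
qed

end

theorem theorem4p9:
  fixes X :: "'a set" and d :: "'a \<Rightarrow> 'a \<Rightarrow> real"
    and R :: "'a set" and q :: 'a and k :: nat
    and T :: "'a rooted_tree" and grp :: "'a \<Rightarrow> int \<Rightarrow> 'a list"
    and c c\<^sub>m :: real
  assumes "Metric_space X d"
    and "finite R" and "R \<subseteq> X" and "q \<in> X"
    and "1 \<le> k" and "k \<le> card R"
    and "compressed_cover_tree d R T"
    and "stores_children T grp"
  defines "c \<equiv> Metric_space.expansion_constant X d (R \<union> {q})"
    and "c\<^sub>m \<equiv> Metric_space.minimized_expansion_constant X d R"
  shows "\<exists>us time. knn d T grp q k = Some (us, time) \<and>
           all_k_nearest_neighbors d k q R us \<and>
           real time \<le> time_constant *
             (c\<^sup>2 * log_factor k * (c\<^sub>m ^ 10 * log_factor (card R) + c * k))"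
proof -
  interpret Metric_space X d by fact
  interpret knn_problem X d R T q k grp
    by unfold_locales (use assms in auto)
  show ?thesis unfolding c_def c\<^sub>m_def by (rule knn_correct)
qed

end
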